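(* For every integer $d\geq 3$ and every odd integer $g\geq 7$ there exist infinitely many mutually rigid $d$-regular graphs of odd girth $g$.
   Context: All graphs are finite, simple and undirected. A homomorphism between graphs is a map of vertex sets sending edges to edges. A graph is rigid if its only endomorphism is the identity. A family of graphs is mutually rigid if every member is rigid and there is no homomorphism between two different members of the family. The odd girth of a graph is the length of its shortest odd cycle. *)

theory Defs
  imports "Graph_Theory.Pair_Digraph" "HOL-Library.Extended_Nat"
begin

text \<open>
  A finite simple undirected graph is an irreflexive symmetric digraph without parallel arcs
  (locale \<^locale>\<open>pair_graph\<close>): an undirected edge \<open>uv\<close> is the pair of arcs
  \<open>(u, v)\<close>, \<open>(v, u)\<close>.
\<close>

text \<open>Homomorphisms are total functions; only their values on the vertices of \<open>G\<close> matter.\<close>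

definition graph_hom :: "'a pair_pre_digraph \<Rightarrow> 'b pair_pre_digraph \<Rightarrow> ('a \<Rightarrow> 'b) \<Rightarrow> bool" where
  "graph_hom G H h \<longleftrightarrow>
     (\<forall>v \<in> pverts G. h v \<in> pverts H) \<and> (\<forall>(u, v) \<in> parcs G. (h u, h v) \<in> parcs H)"

definition rigid :: "'a pair_pre_digraph \<Rightarrow> bool" where
  "rigid G \<longleftrightarrow> (\<forall>h. graph_hom G G h \<longrightarrow> (\<forall>v \<in> pverts G. h v = v))"

definition mutually_rigid :: "'a pair_pre_digraph set \<Rightarrow> bool" where
  "mutually_rigid F \<longleftrightarrow>
     (\<forall>G \<in> F. rigid G) \<and> (\<forall>G \<in> F. \<forall>H \<in> F. G \<noteq> H \<longrightarrow> \<not> (\<exists>h. graph_hom G H h))"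

text \<open>In a symmetric digraph the out-degree of a vertex is its degree as an undirected graph.\<close>

definition regular_graph :: "nat \<Rightarrow> 'a pair_pre_digraph \<Rightarrow> bool" where
  "regular_graph d G \<longleftrightarrow> (\<forall>v \<in> pverts G. out_degree (with_proj G) v = d)"

text \<open>
  \<^const>\<open>pre_digraph.cycle\<close> also counts the closed walks \<open>u, v, u\<close> along a single
  undirected edge. These have length 2, so the odd cycles are the usual ones.
  The odd girth of a bipartite graph is \<open>\<infinity>\<close>.
\<close>

definition odd_girth :: "'a pair_pre_digraph \<Rightarrow> enat" where
  "odd_girth G =
     (INF p \<in> {p. pre_digraph.cycle (with_proj G) p \<and> odd (length p)}. enat (length p))"

end

theory Submission
  imports Defs
begin

text \<open>
  Put \<open>N = g - 2\<close> and subdivide \<open>K\<^sub>4\<close> so that opposite edges get the lengths \<open>1\<close>, \<open>2\<close> and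
  \<open>N - 1\<close>. All four faces are then cycles of length \<open>g\<close>, there is no shorter odd cycle, and any two
  consecutive edges lie on a face. Since \<open>g \<ge> 7\<close> the three lengths differ, so the locally injective
  endomorphisms form a Klein four-group. Arrange \<open>n\<close> copies of this graph in a ring, joining
  consecutive copies by one edge between asymmetrically chosen vertices, where the first copy uses another
  vertex than the others; then make everything \<open>d\<close>-regular by further edges that lie on no short cycle and
  respect a 2-colouring violated by the ring edges. A homomorphism preserves cycles of length \<open>g\<close>, so it maps
  copies to copies by elements of the four-group, and it maps ring edges to ring edges. This forces
  the identity and equality of the numbers of copies.
\<close>

text \<open>The added edges come from an existence argument, so nothing is known about where they
  run; rigidity has to follow from properties that every admissible completion keeps. Two of them
  suffice. An edge outside the copies lies on no cycle of length at most \<open>g\<close>, so closed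
  walks of length \<open>g\<close>, the least odd length, run inside the copies. And an added edge
  joins vertices of equal colour, one colour class being the middle vertices of the paths of length
  2, the other all remaining vertices. The four-group preserves these classes, so the image of a
  ring edge has ends of different colours and is not an added edge. The price of the colouring is a
  parity condition: in each class the missing degrees must have an even sum, hence the even number
  of copies. That this number is large keeps the cycles round the ring long and supplies deficient
  vertices far from any two given ones.\<close>

section \<open>Walks\<close>

lemma relpow_avoid:
  assumes "(p, q) \<in> R ^^ k"
  shows "(p, q) \<in> (R - E) ^^ k \<or>
    (\<exists>s t a b. (a, b) \<in> R \<inter> E \<and> (p, a) \<in> R ^^ s \<and> (b, q) \<in> R ^^ t \<and> s + t + 1 = k)"
  using assms
proof (induction k arbitrary: p)
  case (Suc k)
  from Suc.prems obtain p' where p': "(p, p') \<in> R" "(p', q) \<in> R ^^ k"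
    by (meson relpow_Suc_D2)
  show ?case
  proof (cases "(p, p') \<in> E")
    case True
    with p' have "(p, p') \<in> R \<inter> E \<and> (p, p) \<in> R ^^ 0 \<and> (p', q) \<in> R ^^ k \<and> 0 + k + 1 = Suc k"
      by simp
    then show ?thesis by blast
  next
    case False
    from Suc.IH[OF p'(2)] show ?thesis
    proof (elim disjE exE conjE)
      assume "(p', q) \<in> (R - E) ^^ k"
      with False p'(1) have "(p, q) \<in> (R - E) ^^ Suc k"
        by (meson Diff_iff relpow_Suc_I2)
      then show ?thesis by blast
    next
      fix s t a b
      assume *: "(a, b) \<in> R \<inter> E" "(p', a) \<in> R ^^ s" "(b, q) \<in> R ^^ t" "s + t + 1 = k"
      from p'(1) *(2) have "(p, a) \<in> R ^^ Suc s" by (rule relpow_Suc_I2)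
      moreover have "Suc s + t + 1 = Suc k" using * by simp
      ultimately show ?thesis using *(1,3) by blast
    qed
  qed
qed auto

lemma relpow_insert_edge:
  assumes "(p, q) \<in> (R \<union> {(u, v), (v, u)}) ^^ k"
  shows "(\<exists>j\<le>k. (p, q) \<in> R ^^ j) \<or>
    (\<exists>s t. s + t + 1 \<le> k \<and>
      ((p, u) \<in> R ^^ s \<and> (v, q) \<in> R ^^ t \<or> (p, v) \<in> R ^^ s \<and> (u, q) \<in> R ^^ t))"
  using assms
proof (induction k arbitrary: p)
  case (Suc k)
  from Suc.prems obtain p' where p': "(p, p') \<in> R \<union> {(u, v), (v, u)}"
    "(p', q) \<in> (R \<union> {(u, v), (v, u)}) ^^ k"
    by (meson relpow_Suc_D2)
  from Suc.IH[OF p'(2)] consider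
      (a) j where "j \<le> k" "(p', q) \<in> R ^^ j"
    | (b) s t where "s + t + 1 \<le> k" "(p', u) \<in> R ^^ s" "(v, q) \<in> R ^^ t"
    | (c) s t where "s + t + 1 \<le> k" "(p', v) \<in> R ^^ s" "(u, q) \<in> R ^^ t"
    by blast
  note cs = this
  have 0: "(x, x) \<in> R ^^ 0" for x by simp
  consider (R) "(p, p') \<in> R" | (uv) "p = u" "p' = v" | (vu) "p = v" "p' = u"
    using p'(1) by blast
  then show ?case
  proof cases
    case R
    from cs show ?thesis
    proof cases
      case a
      then have "Suc j \<le> Suc k" "(p, q) \<in> R ^^ Suc j" using R relpow_Suc_I2 by (simp, metis)
      then show ?thesis by blast
    next
      case b
      then have "Suc s + t + 1 \<le> Suc k" "(p, u) \<in> R ^^ Suc s" using R relpow_Suc_I2 by (simp, metis)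
      then show ?thesis using b by blast
    next
      case c
      then have "Suc s + t + 1 \<le> Suc k" "(p, v) \<in> R ^^ Suc s" using R relpow_Suc_I2 by (simp, metis)
      then show ?thesis using c by blast
    qed
  next
    case uv
    from cs show ?thesis
    proof cases
      case a
      then have "0 + j + 1 \<le> Suc k" by simp
      then show ?thesis using uv a 0[of u] by blast
    next
      case b
      then have "0 + t + 1 \<le> Suc k" by simp
      then show ?thesis using uv b 0[of u] by blast
    next
      case c
      then have "t \<le> Suc k" by simp
      then show ?thesis using uv c by blast
    qed
  next
    case vu
    from cs show ?thesis
    proof cases
      case a
      then have "0 + j + 1 \<le> Suc k" by simp
      then show ?thesis using vu a 0[of v] by blast
    next
      case b
      then have "t \<le> Suc k" by simp
      then show ?thesis using vu b by blast
    next
      case c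
      then have "0 + t + 1 \<le> Suc k" by simp
      then show ?thesis using vu c 0[of v] by blast
    qed
  qed
qed auto

lemma sym_relpow: "sym R \<Longrightarrow> (x, y) \<in> R ^^ k \<Longrightarrow> (y, x) \<in> R ^^ k"
proof (induction k arbitrary: y)
  case (Suc k)
  then obtain z where "(x, z) \<in> R ^^ k" "(z, y) \<in> R" by auto
  with Suc show ?case by (meson relpow_Suc_I2 symD)
qed auto

lemma relpow_add_I: "(x, y) \<in> R ^^ i \<Longrightarrow> (y, z) \<in> R ^^ j \<Longrightarrow> (x, z) \<in> R ^^ (i + j)"
  by (auto simp: relpow_add)

lemma relpow_le_mono:
  fixes R :: "'a rel"
  shows "R \<subseteq> S \<Longrightarrow> (x, y) \<in> R ^^ k \<Longrightarrow> (x, y) \<in> S ^^ k"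
proof (induction k arbitrary: y)
  case (Suc k)
  then obtain z where "(x, z) \<in> R ^^ k" "(z, y) \<in> R" by auto
  with Suc show ?case by (meson relpow_Suc_I subsetD)
qed auto

lemma card_relpow_Image_le:
  fixes R :: "'a rel"
  assumes "finite R" "\<And>v. card (R `` {v}) \<le> d"
  shows "finite ((R ^^ k) `` {v}) \<and> card ((R ^^ k) `` {v}) \<le> d ^ k"
proof (induction k)
  case (Suc k)
  have eq: "(R ^^ Suc k) `` {v} = (\<Union>w\<in>(R ^^ k) `` {v}. R `` {w})" by auto
  have "card (\<Union>w\<in>(R ^^ k) `` {v}. R `` {w}) \<le> (\<Sum>w\<in>(R ^^ k) `` {v}. card (R `` {w}))"
    using Suc by (intro card_UN_le) auto
  also have "\<dots> \<le> card ((R ^^ k) `` {v}) * d"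
    using assms(2) by (metis sum_bounded_above of_nat_id)
  also have "\<dots> \<le> d ^ k * d" using Suc by simp
  finally show ?case using Suc assms(1) unfolding eq by (auto simp: mult.commute)
qed auto

text \<open>Distance at least \<open>g\<close>. In \<open>R\<close> without the edge
  \<open>uv\<close> it says that \<open>uv\<close> lies on no cycle of \<open>R\<close> of length at
  most \<open>g\<close>, the rest of such a cycle being a walk of length below
  \<open>g\<close>.\<close>

definition far :: "nat \<Rightarrow> 'a rel \<Rightarrow> 'a \<Rightarrow> 'a \<Rightarrow> bool" where
  "far g R u v \<longleftrightarrow> (\<forall>k<g. (u, v) \<notin> R ^^ k)"

lemma not_far_refl: "g > 0 \<Longrightarrow> \<not> far g R a a"
  unfolding far_def by (metis relpow_0_I)

lemma far_mono: "S \<subseteq> R \<Longrightarrow> far g R u v \<Longrightarrow> far g S u v"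
  unfolding far_def using relpow_le_mono by metis

lemma far_sym: "sym R \<Longrightarrow> far g R u v \<Longrightarrow> far g R v u"
  unfolding far_def using sym_relpow by metis

lemma even_card_sym_irrefl:
  fixes R :: "'a rel"
  assumes "finite R" "sym R" "irrefl R"
  shows "even (card R)"
  using assms
proof (induction "card R" arbitrary: R rule: less_induct)
  case less
  show ?case
  proof (cases "R = {}")
    case False
    then obtain a b where ab: "(a, b) \<in> R" by auto
    then have ba: "(b, a) \<in> R" "a \<noteq> b" using less.prems by (auto dest: symD simp: irrefl_def)
    let ?S = "R - {(a, b), (b, a)}"
    have c: "card ?S = card R - 2" "card R \<ge> 2"
      using ab ba less.prems(1) card_mono[of R "{(a, b), (b, a)}"]
      by (auto simp: card_Diff_subset)
    have "sym ?S" "irrefl ?S" using less.prems by (auto simp: sym_def irrefl_def)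
    then have "even (card ?S)" using c less.prems by (intro less.hyps) auto
    then show ?thesis using c by auto
  qed simp
qed

section \<open>Completion to a regular graph\<close>

locale regular_completion =
  fixes V :: "'a set" and B C :: "'a rel" and col :: "'a \<Rightarrow> 'c" and d g :: nat
  assumes finV: "finite V"
begin

text \<open>Edges of \<open>B\<close> may lie on short cycles, and edges of \<open>B\<close> and
  \<open>C\<close> may violate the colouring: \<open>B\<close> will be the copies and
  \<open>C\<close> the ring. Degrees are only bounded, so that the class contains the starting graph
  and is closed under removing an added edge.\<close>

definition good :: "'a rel \<Rightarrow> bool" where
  "good R \<longleftrightarrow> sym R \<and> R \<subseteq> V \<times> V \<and> B \<union> C \<subseteq> R \<and> (\<forall>v\<in>V. card (R `` {v}) \<le> d) \<and>
    (\<forall>u v. (u, v) \<in> R - B \<longrightarrow> far g (R - {(u, v), (v, u)}) u v) \<and>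
    (\<forall>u v. (u, v) \<in> R - (B \<union> C) \<longrightarrow> col u = col v)"

lemma goodI:
  assumes "sym R" "R \<subseteq> V \<times> V" "B \<union> C \<subseteq> R" "\<And>v. v \<in> V \<Longrightarrow> card (R `` {v}) \<le> d"
    and "\<And>u v. (u, v) \<in> R - B \<Longrightarrow> far g (R - {(u, v), (v, u)}) u v"
    and "\<And>u v. (u, v) \<in> R - (B \<union> C) \<Longrightarrow> col u = col v"
  shows "good R"
  using assms unfolding good_def by simp

lemma goodD:
  assumes "good R"
  shows "sym R" "R \<subseteq> V \<times> V" "B \<union> C \<subseteq> R" "\<And>v. v \<in> V \<Longrightarrow> card (R `` {v}) \<le> d"
    and "\<And>u v. (u, v) \<in> R - B \<Longrightarrow> far g (R - {(u, v), (v, u)}) u v"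
    and "\<And>u v. (u, v) \<in> R - (B \<union> C) \<Longrightarrow> col u = col v"
  using assms unfolding good_def by blast+

text \<open>If a short detour for \<open>pq\<close> ran over the new edge, its two remaining pieces
  joined by the edge \<open>pq\<close> itself would be a walk from \<open>u\<close> to
  \<open>v\<close> in \<open>R\<close> that is no longer.\<close>

lemma far_edges_insert:
  assumes R: "sym R" "\<And>p q. (p, q) \<in> R - B \<Longrightarrow> far g (R - {(p, q), (q, p)}) p q"
    and uv: "far g R u v"
    and pq: "(p, q) \<in> (R \<union> {(u, v), (v, u)}) - B"
  shows "far g (R \<union> {(u, v), (v, u)} - {(p, q), (q, p)}) p q"
proof (cases "(p, q) \<in> {(u, v), (v, u)}")
  case True
  then show ?thesis using uv far_sym[OF R(1) uv] by (auto elim!: far_mono[rotated])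
next
  case False
  with pq have pqR: "(p, q) \<in> R - B" by auto
  let ?S = "R - {(p, q), (q, p)}"
  have S: "?S \<subseteq> R" by auto
  have qp: "(q, p) \<in> R" "(p, q) \<in> R" using pqR R(1) by (auto dest: symD)
  have far_pq: "far g ?S p q" using R(2) pqR by blast
  show ?thesis unfolding far_def
  proof (intro allI impI notI)
    fix k assume k: "k < g" "(p, q) \<in> (R \<union> {(u, v), (v, u)} - {(p, q), (q, p)}) ^^ k"
    then have "(p, q) \<in> (?S \<union> {(u, v), (v, u)}) ^^ k"
      by (auto elim!: relpow_le_mono[rotated])
    from relpow_insert_edge[OF this] consider
      (a) j where "j \<le> k" "(p, q) \<in> ?S ^^ j"
    | (b) s t where "s + t + 1 \<le> k" "(p, u) \<in> ?S ^^ s" "(v, q) \<in> ?S ^^ t"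
    | (c) s t where "s + t + 1 \<le> k" "(p, v) \<in> ?S ^^ s" "(u, q) \<in> ?S ^^ t"
      by blast
    then show False
    proof cases
      case a
      then show ?thesis using far_pq k by (auto simp: far_def)
    next
      case b
      have "(u, p) \<in> R ^^ s" "(q, v) \<in> R ^^ t"
        using b sym_relpow[OF R(1)] relpow_le_mono[OF S] by metis+
      then have "(u, v) \<in> R ^^ (s + (1 + t))"
        using qp by (intro relpow_add_I[of u p] relpow_add_I[of p q]) auto
      moreover have "s + (1 + t) < g" using b k by simp
      ultimately show ?thesis using uv unfolding far_def by blast
    next
      case c
      have "(p, v) \<in> R ^^ s" "(u, q) \<in> R ^^ t"
        using c relpow_le_mono[OF S] by metis+
      then have "(u, v) \<in> R ^^ (t + (1 + s))"
        using qp by (intro relpow_add_I[of u q] relpow_add_I[of q p]) auto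
      moreover have "t + (1 + s) < g" using c k by simp
      ultimately show ?thesis using uv unfolding far_def by blast
    qed
  qed
qed

lemma good_insert:
  assumes good: "good R" and uv: "far g R u v" "u \<in> V" "v \<in> V" "col u = col v" "u \<noteq> v"
    and "card (R `` {u}) < d" "card (R `` {v}) < d"
  shows "good (R \<union> {(u, v), (v, u)})"
proof (rule goodI)
  note R = goodD[OF good]
  let ?R = "R \<union> {(u, v), (v, u)}"
  show "card (?R `` {w}) \<le> d" if "w \<in> V" for w
  proof -
    have "?R `` {w} = (if w = u then insert v (R `` {w}) else if w = v then insert u (R `` {w}) else R `` {w})"
      using uv by auto
    moreover have "card (insert x (R `` {w})) \<le> Suc (card (R `` {w}))" for x
      by (rule card_insert_le_m1) auto
    ultimately show ?thesis using assms(7,8) R(4)[OF that]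
      by (smt (verit) Suc_leI order_trans)
  qed
  show "far g (?R - {(p, q), (q, p)}) p q" if "(p, q) \<in> ?R - B" for p q
    by (rule far_edges_insert[OF R(1) R(5) uv(1) that])
  show "sym ?R" using R(1) unfolding sym_def by blast
  show "?R \<subseteq> V \<times> V" using R(2) uv by blast
  show "B \<union> C \<subseteq> ?R" using R(3) by blast
  show "col p = col q" if "(p, q) \<in> ?R - (B \<union> C)" for p q
    using that R(6) uv(4) by auto
qed

lemma good_remove:
  assumes good: "good R" and xy: "(x, y) \<in> R - (B \<union> C)" and "sym B" "sym C"
  shows "good (R - {(x, y), (y, x)})"
proof (rule goodI)
  note R = goodD[OF good]
  let ?R = "R - {(x, y), (y, x)}"
  have fin: "finite R" using R(2) finV by (meson finite_SigmaI finite_subset)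
  show "card (?R `` {w}) \<le> d" if "w \<in> V" for w
  proof -
    have "card (?R `` {w}) \<le> card (R `` {w})"
      using fin by (intro card_mono finite_Image) auto
    then show ?thesis using R(4)[OF that] by simp
  qed
  show "far g (?R - {(p, q), (q, p)}) p q" if "(p, q) \<in> ?R - B" for p q
    using that by (intro far_mono[OF _ R(5)]) auto
  show "sym ?R" using R(1) unfolding sym_def by blast
  show "?R \<subseteq> V \<times> V" using R(2) by blast
  show "B \<union> C \<subseteq> ?R" using R(3) xy \<open>sym B\<close> \<open>sym C\<close> by (auto dest: symD)
  show "col p = col q" if "(p, q) \<in> ?R - (B \<union> C)" for p q
    using that R(6) by auto
qed

lemma card_insert_edge:
  assumes "finite R" "(u, v) \<notin> R" "(v, u) \<notin> R" "u \<noteq> v"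
  shows "card (R \<union> {(u, v), (v, u)}) = card R + 2"
  using assms by (subst card_Un_disjoint) auto

text \<open>An added edge is monochromatic and, its ends being \<open>far\<close>, no loop; so it
  uses up two units of missing degree in a single colour class, and the parity is that of
  \<open>B \<union> C\<close>.\<close>

lemma even_deficiency:
  assumes good: "good R" "good (B \<union> C)" "g > 0"
    and even: "even (\<Sum>v | v \<in> V \<and> col v = c. d - card ((B \<union> C) `` {v}))"
  shows "even (\<Sum>v | v \<in> V \<and> col v = c. d - card (R `` {v}))"
proof -
  note R = goodD[OF good(1)] and R0 = goodD[OF good(2)]
  let ?A = "{v \<in> V. col v = c}" and ?N = "R - (B \<union> C)"
  have fin: "finite R" "finite (B \<union> C)" using R(2) R0(2) finV by (meson finite_SigmaI finite_subset)+
  have finA: "finite ?A" using finV by simp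
  let ?M = "{e \<in> ?N. fst e \<in> ?A}"
  have "sym ?M"
  proof (rule symI)
    fix a b assume "(a, b) \<in> ?M"
    then show "(b, a) \<in> ?M"
      using R(1,2) R0(1) R(6)[of a b] by (auto dest: symD)
  qed
  moreover have "irrefl ?M"
  proof (rule irreflI)
    fix a show "(a, a) \<notin> ?M"
    proof
      assume "(a, a) \<in> ?M"
      then have "far g (R - {(a, a), (a, a)}) a a" by (intro R(5)) auto
      then show False by (simp add: not_far_refl[OF \<open>g > 0\<close>])
    qed
  qed
  ultimately have evM: "even (card ?M)" using fin by (intro even_card_sym_irrefl) auto
  have "?M = Sigma ?A (\<lambda>v. ?N `` {v})" by auto
  then have "card ?M = (\<Sum>v\<in>?A. card (?N `` {v}))"
    using finA fin by (simp add: card_SigmaI finite_Image)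
  moreover have "card (R `` {v}) = card ((B \<union> C) `` {v}) + card (?N `` {v})" for v
  proof -
    have "R `` {v} = (B \<union> C) `` {v} \<union> ?N `` {v}" using R(3) by auto
    then show ?thesis using fin by (simp add: card_Un_disjoint finite_Image disjoint_iff)
  qed
  moreover have "(\<Sum>v\<in>?A. d - card ((B \<union> C) `` {v})) = (\<Sum>v\<in>?A. (d - card (R `` {v})) + card (?N `` {v}))"
  proof (rule sum.cong[OF refl])
    fix v assume "v \<in> ?A"
    then have "card (R `` {v}) \<le> d" using R(4) by blast
    then show "d - card ((B \<union> C) `` {v}) = (d - card (R `` {v})) + card (?N `` {v})"
      using calculation(2)[of v] by linarith
  qed
  ultimately show ?thesis using even evM by (simp add: sum.distrib)
qed

text \<open>An extremal argument: in an admissible graph with the most edges, a deficient vertex \<open>u\<close> has by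
  parity a deficient partner \<open>v\<close> of its colour (possibly \<open>u\<close> itself). Take an initially deficient
  \<open>x\<close> of that colour far from both. If \<open>x\<close> is still deficient, add \<open>ux\<close>; otherwise \<open>x\<close> has an added edge
  \<open>xy\<close>, which is replaced by \<open>ux\<close> and \<open>vy\<close>.\<close>

theorem exists_regular:
  assumes good0: "good (B \<union> C)" and sym: "sym B" "sym C" and "g > 1"
    and even: "\<And>c. even (\<Sum>v | v \<in> V \<and> col v = c. d - card ((B \<union> C) `` {v}))"
    and many: "\<And>u. u \<in> V \<Longrightarrow>
      card {v \<in> V. col v = col u \<and> card ((B \<union> C) `` {v}) < d} > 2 * (\<Sum>k\<le>g. d ^ k)"
  shows "\<exists>R. good R \<and> (\<forall>v\<in>V. card (R `` {v}) = d)"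
proof -
  have "card S \<le> card (V \<times> V)" if "good S" for S
    using goodD(2)[OF that] finV by (intro card_mono) auto
  then have "\<exists>R. good R \<and> (\<forall>S. good S \<longrightarrow> card S \<le> card R)"
    using good0 by (intro ex_has_greatest_nat[where k = "B \<union> C" and b = "Suc (card (V \<times> V))"])
      (auto simp: less_Suc_eq_le)
  then obtain R where good: "good R" and max: "\<And>S. good S \<Longrightarrow> card S \<le> card R"
    by blast
  note R = goodD[OF good] and R0 = goodD[OF good0]
  have fin: "finite R" using R(2) finV by (meson finite_SigmaI finite_subset)
  have deg: "card (R `` {v}) \<le> d" for v
  proof (cases "v \<in> V")
    case False
    then have "R `` {v} = {}" using R(2) by auto
    then show ?thesis by simp
  qed (rule R(4))
  have False if u: "u \<in> V" "card (R `` {u}) \<noteq> d" for u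
  proof -
    have du: "card (R `` {u}) < d" using R(4)[OF u(1)] u(2) by simp
    let ?A = "{v \<in> V. col v = col u}"
    have ev: "even (\<Sum>v\<in>?A. d - card (R `` {v}))"
      using \<open>g > 1\<close> by (intro even_deficiency[OF good good0 _ even]) simp
    \<comment> \<open>If \<open>v = u\<close>, both new edges \<open>ux\<close> and
      \<open>vy\<close> end in \<open>u\<close>, which must then lack two. If \<open>u\<close> lacks
      exactly one, parity supplies another vertex.\<close>
    obtain v where v: "v \<in> V" "col v = col u" "card (R `` {v}) < d"
      "v = u \<Longrightarrow> card (R `` {u}) + 2 \<le> d"
    proof (cases "card (R `` {u}) + 2 \<le> d")
      case False
      then have "d - card (R `` {u}) = 1" using du by simp
      moreover have "(\<Sum>v\<in>?A. d - card (R `` {v})) = (d - card (R `` {u})) + (\<Sum>v\<in>?A - {u}. d - card (R `` {v}))"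
        using u finV by (intro sum.remove) auto
      ultimately have "odd (\<Sum>v\<in>?A - {u}. d - card (R `` {v}))" using ev by simp
      then have "\<not> (\<forall>v\<in>?A - {u}. d - card (R `` {v}) = 0)"
        by (intro notI) (simp only: sum.neutral even_zero simp_thms)
      then obtain v where "v \<in> ?A - {u}" "d - card (R `` {v}) \<noteq> 0" by blast
      then show ?thesis by (intro that[of v]) auto
    qed (use u du that in auto)
    \<comment> \<open>Degrees are at most \<open>d\<close>, which bounds a ball of radius
      \<open>g\<close>; the factor 2 in \<open>many\<close> pays for the balls round
      \<open>u\<close> and \<open>v\<close>.\<close>
    let ?ball = "\<lambda>w. (\<Union>k\<le>g. (R ^^ k) `` {w})"
    have ball: "finite (?ball w)" "card (?ball w) \<le> (\<Sum>k\<le>g. d ^ k)" for w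
    proof -
      note * = card_relpow_Image_le[OF fin deg, of _ w]
      show "finite (?ball w)" using * by blast
      have "card (?ball w) \<le> (\<Sum>k\<le>g. card ((R ^^ k) `` {w}))" by (intro card_UN_le) auto
      also have "\<dots> \<le> (\<Sum>k\<le>g. d ^ k)" using * by (intro sum_mono) blast
      finally show "card (?ball w) \<le> (\<Sum>k\<le>g. d ^ k)" .
    qed
    let ?D = "{v \<in> V. col v = col u \<and> card ((B \<union> C) `` {v}) < d}"
    have "\<not> ?D \<subseteq> ?ball u \<union> ?ball v"
    proof
      assume "?D \<subseteq> ?ball u \<union> ?ball v"
      then have "card ?D \<le> card (?ball u \<union> ?ball v)" using ball by (intro card_mono) auto
      also have "\<dots> \<le> card (?ball u) + card (?ball v)" by (rule card_Un_le)
      also have "\<dots> \<le> 2 * (\<Sum>k\<le>g. d ^ k)" using ball(2)[of u] ball(2)[of v] by simp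
      finally show False using many[OF u(1)] by simp
    qed
    \<comment> \<open>\<open>Suc g\<close> instead of \<open>g\<close>, since in the exchange it is
      the neighbour \<open>y\<close> of \<open>x\<close> that must be far from
      \<open>v\<close>.\<close>
    then obtain x where x: "x \<in> V" "col x = col u" "card ((B \<union> C) `` {x}) < d"
      and far: "far (Suc g) R u x" "far (Suc g) R v x"
      by (auto simp: far_def less_Suc_eq_le)
    have far': "far g R u x" "far g R v x" using far by (auto simp: far_def)
    have ne: "u \<noteq> x" "v \<noteq> x" using far not_far_refl[of "Suc g"] by (metis zero_less_Suc)+
    have nR: "(u, x) \<notin> R" "(x, u) \<notin> R" "(v, x) \<notin> R" "(x, v) \<notin> R"
    proof -
      have "1 < Suc g" using \<open>g > 1\<close> by simp
      then have "(u, x) \<notin> R ^^ 1" "(v, x) \<notin> R ^^ 1" using far unfolding far_def by blast+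
      then show "(u, x) \<notin> R" "(x, u) \<notin> R" "(v, x) \<notin> R" "(x, v) \<notin> R" using R(1) by (auto dest: symD)
    qed
    show False
    proof (cases "card (R `` {x}) < d")
      case True
      then have "good (R \<union> {(u, x), (x, u)})"
        using good far' u x du ne by (intro good_insert) auto
      then show ?thesis using max card_insert_edge[OF fin nR(1,2) ne(1)] by fastforce
    next
      case False
      have "\<not> R `` {x} \<subseteq> (B \<union> C) `` {x}"
      proof
        assume "R `` {x} \<subseteq> (B \<union> C) `` {x}"
        then have "R `` {x} = (B \<union> C) `` {x}" using R(3) by blast
        then show False using False x by simp
      qed
      then obtain y where xy: "(x, y) \<in> R - (B \<union> C)" by auto
      have yV: "y \<in> V" "col y = col u" using R(2) R(6)[OF xy] xy x by auto
      have yx: "(y, x) \<in> R" using xy R(1) by (auto dest: symD)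
      have xny: "x \<noteq> y" using R(5)[OF DiffI, of x y] xy \<open>g > 1\<close> not_far_refl[of g] by (metis DiffD1 DiffD2 UnI1 gr_implies_not0 gr0I)
      have yuv: "y \<noteq> u" "y \<noteq> v" using xy nR by auto
      let ?R1 = "R - {(x, y), (y, x)}"
      have g1: "good ?R1" by (rule good_remove[OF good xy sym])
      have R1: "?R1 \<subseteq> R" by auto
      have fin1: "finite ?R1" using fin by simp
      have d1: "card (?R1 `` {w}) \<le> card (R `` {w})" for w
        using fin by (intro card_mono finite_Image) auto
      have d1': "card (?R1 `` {w}) < d" if "w = x \<or> w = y" for w
      proof -
        have "?R1 `` {w} \<subset> R `` {w}" using that xy yx xny by auto
        then have "card (?R1 `` {w}) < card (R `` {w})" using fin by (intro psubset_card_mono finite_Image)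
        then show ?thesis using deg[of w] by simp
      qed
      let ?R2 = "?R1 \<union> {(u, x), (x, u)}"
      have g2: "good ?R2"
        using far_mono[OF R1 far'(1)] u x d1[of u] d1' du ne by (intro good_insert g1) auto
      \<comment> \<open>A walk that avoids \<open>ux\<close> extends by \<open>yx\<close> to a walk
        from \<open>v\<close> to \<open>x\<close>; one that passes from \<open>u\<close> to
        \<open>x\<close> ends with a detour for the added edge \<open>xy\<close>; one that passes
        from \<open>x\<close> to \<open>u\<close> has reached \<open>x\<close> before. None of them
        can be short.\<close>
      have far2: "far g ?R2 v y" unfolding far_def
      proof (intro allI impI notI)
        fix k assume k: "k < g" "(v, y) \<in> ?R2 ^^ k"
        have yx1: "(y, x) \<in> R ^^ 1" using yx by simp
        from relpow_insert_edge[OF k(2)] consider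
          (a) j where "j \<le> k" "(v, y) \<in> ?R1 ^^ j"
        | (b) s t where "s + t + 1 \<le> k" "(v, u) \<in> ?R1 ^^ s" "(x, y) \<in> ?R1 ^^ t"
        | (c) s t where "s + t + 1 \<le> k" "(v, x) \<in> ?R1 ^^ s" "(u, y) \<in> ?R1 ^^ t"
          by blast
        then show False
        proof cases
          case a
          then have "(v, x) \<in> R ^^ (j + 1)" using relpow_le_mono[OF R1] yx1 by (blast intro: relpow_add_I)
          then show ?thesis using far(2) a k unfolding far_def
            by (metis Suc_eq_plus1 Suc_mono order_le_less_trans)
        next
          case b
          then show ?thesis using R(5)[of x y] xy k by (auto simp: far_def)
        next
          case c
          then have "(v, x) \<in> R ^^ s" using relpow_le_mono[OF R1] by blast
          moreover have "s < g" using c k by simp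
          ultimately show ?thesis using far'(2) unfolding far_def by blast
        qed
      qed
      have d2y: "card (?R2 `` {y}) < d"
      proof -
        have "?R2 `` {y} = ?R1 `` {y}" using yuv xny by auto
        then show ?thesis using d1' by simp
      qed
      have d2v: "card (?R2 `` {v}) < d"
      proof (cases "v = u")
        case True
        have "?R2 `` {v} = insert x (?R1 `` {u})" using True ne by auto
        also have "card \<dots> \<le> Suc (card (?R1 `` {u}))" by (rule card_insert_le_m1) auto
        finally show ?thesis using d1[of u] v(4)[OF True] by simp
      next
        case False
        then have "?R2 `` {v} = ?R1 `` {v}" using ne by auto
        then show ?thesis using d1[of v] v by simp
      qed
      have "good (?R2 \<union> {(v, y), (y, v)})"
        using v yV yuv by (intro good_insert g2 far2 d2y d2v) auto
      moreover have "card (?R2 \<union> {(v, y), (y, v)}) = card ?R2 + 2"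
      proof (rule card_insert_edge)
        have "(v, y) \<notin> ?R2 ^^ 1" using far2 \<open>g > 1\<close> unfolding far_def by blast
        then show "(v, y) \<notin> ?R2" "(y, v) \<notin> ?R2" using goodD(1)[OF g2] by (auto dest: symD)
      qed (use fin yuv in auto)
      moreover have "card ?R2 = card ?R1 + 2"
        using nR ne by (intro card_insert_edge fin1) auto
      moreover have "card ?R1 + 2 = card R"
      proof -
        have "R = ?R1 \<union> {(x, y), (y, x)}" using xy yx by auto
        then show ?thesis using card_insert_edge[OF fin1, of x y] xny by auto
      qed
      ultimately show False using max by fastforce
    qed
  qed
  then show ?thesis using good by blast
qed

end

section \<open>The subdivided tetrahedron\<close>

text \<open>The subdivided \<open>K\<^sub>4\<close> as the cycle \<open>0, \<dots>, 2N - 1\<close> together with the paths \<open>0, 2N, N\<close> and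
  \<open>1, 2N + 1, N + 1\<close> between antipodal vertices; the branch vertices are \<open>0, 1, N, N + 1\<close>.\<close>

definition box_adj :: "nat \<Rightarrow> nat \<Rightarrow> nat \<Rightarrow> bool" where
  "box_adj N x y \<longleftrightarrow> y = Suc x \<and> y < 2 * N \<or> x = 0 \<and> y = 2 * N - 1 \<or>
     (x = 0 \<or> x = N) \<and> y = 2 * N \<or> (x = 1 \<or> x = N + 1) \<and> y = 2 * N + 1"

definition box :: "nat \<Rightarrow> nat rel" where
  "box N = {(x, y). box_adj N x y \<or> box_adj N y x}"

lemma box_adj_cases:
  assumes "box_adj N v w"
  obtains "w = Suc v" "w < 2 * N" | "v = 0" "w = 2 * N - 1"
    | "v = 0" "w = 2 * N" | "v = N" "w = 2 * N" | "v = 1" "w = 2 * N + 1"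
    | "v = N + 1" "w = 2 * N + 1"
  using assms unfolding box_adj_def by blast

lemma sym_box: "sym (box N)"
  unfolding box_def sym_def by auto

lemma box_bounds: "N \<ge> 2 \<Longrightarrow> (x, y) \<in> box N \<Longrightarrow> x < 2 * N + 2 \<and> y < 2 * N + 2 \<and> x \<noteq> y"
  unfolding box_def box_adj_def by auto

lemma box_nbrs_arc:
  assumes "2 \<le> x \<and> x < N \<or> N + 2 \<le> x \<and> x < 2 * N - 1"
  shows "(x, y) \<in> box N \<longleftrightarrow> y = x - 1 \<or> y = x + 1"
proof -
  have *: "x \<noteq> 0" "x \<noteq> 1" "x \<noteq> N" "x \<noteq> N + 1" "x < 2 * N - 1" "Suc x < 2 * N"
    using assms by linarith+
  then have A: "box_adj N x y \<longleftrightarrow> y = Suc x"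
    unfolding box_adj_def by auto
  have B: "box_adj N y x \<longleftrightarrow> x = Suc y"
    using * unfolding box_adj_def by auto
  have "(x, y) \<in> box N \<longleftrightarrow> y = Suc x \<or> x = Suc y"
    by (simp add: box_def A B)
  also have "\<dots> \<longleftrightarrow> y = x - 1 \<or> y = x + 1"
    using *(1) by presburger
  finally show ?thesis .
qed

lemma box_nbrs:
  assumes "N \<ge> 5"
  shows "(0, y) \<in> box N \<longleftrightarrow> y = 1 \<or> y = 2 * N - 1 \<or> y = 2 * N"
    "(1, y) \<in> box N \<longleftrightarrow> y = 0 \<or> y = 2 \<or> y = 2 * N + 1"
    "(N, y) \<in> box N \<longleftrightarrow> y = N - 1 \<or> y = N + 1 \<or> y = 2 * N"
    "(N + 1, y) \<in> box N \<longleftrightarrow> y = N \<or> y = N + 2 \<or> y = 2 * N + 1"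
    "(2 * N, y) \<in> box N \<longleftrightarrow> y = 0 \<or> y = N"
    "(2 * N + 1, y) \<in> box N \<longleftrightarrow> y = 1 \<or> y = N + 1"
  using assms unfolding box_def box_adj_def by auto

lemma box_nbrs_last:
  assumes "N \<ge> 5"
  shows "(2 * N - 1, y) \<in> box N \<longleftrightarrow> y = 2 * N - 2 \<or> y = 0"
proof -
  obtain M where N: "N = Suc M" "M \<ge> 4" using assms by (cases N) auto
  have "box_adj N (2 * N - 1) y \<longleftrightarrow> False" "box_adj N y (2 * N - 1) \<longleftrightarrow> y = 2 * M \<or> y = 0"
    using N(2) unfolding box_adj_def N by auto
  then show ?thesis by (simp add: box_def N)
qed

lemma box_vertex_cases:
  fixes x N :: nat
  assumes "x < 2 * N + 2"
  obtains "x = 0" | "x = 1" | "x = N" | "x = N + 1" | "x = 2 * N" | "x = 2 * N + 1"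
    | "2 \<le> x" "x < N" | "N + 2 \<le> x" "x < 2 * N - 1" | "x = 2 * N - 1"
  using assms by linarith

lemma box_arc:
  assumes "x \<le> y" "y < 2 * N"
  shows "(x, y) \<in> box N ^^ (y - x)"
  using assms
proof (induction y)
  case (Suc y)
  show ?case
  proof (cases "x \<le> y")
    case True
    then have "(x, y) \<in> box N ^^ (y - x)" using Suc by simp
    moreover have "(y, Suc y) \<in> box N" using Suc.prems unfolding box_def box_adj_def by auto
    ultimately show ?thesis using True by (simp add: Suc_diff_le, blast)
  next
    case False
    then show ?thesis using Suc.prems by (simp add: le_Suc_eq)
  qed
qed auto

lemma box_arc':
  assumes "x \<le> y" "y < 2 * N"
  shows "(y, x) \<in> box N ^^ (y - x)"
  using sym_relpow[OF sym_box box_arc[OF assms]] .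

text \<open>The four faces of the subdivided tetrahedron are closed walks of length \<open>N + 2\<close>; any two
  consecutive edges lie on a common face.\<close>

lemma box_close_path_less:
  assumes N: "N \<ge> 5" and xy: "(x, y) \<in> box N" "(y, z) \<in> box N" and lt: "x < z"
  shows "(z, x) \<in> box N ^^ N \<or> (x, z) \<in> box N ^^ N"
proof -
  note [simp] = box_nbrs(1)[OF N] box_nbrs(2)[OF N, simplified] box_nbrs(3)[OF N] box_nbrs(4)[OF N, simplified]
    box_nbrs(5)[OF N] box_nbrs(6)[OF N, simplified] box_nbrs_last[OF N, simplified]
  let ?K = "box N"
  have edge: "(a, b) \<in> ?K \<Longrightarrow> (a, b) \<in> ?K ^^ 1" for a b by simp
  have wrap: "(a, 0) \<in> ?K ^^ (2 * N - a)" if "N \<le> a" "a < 2 * N" for a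
  proof -
    have "(a, 0) \<in> ?K ^^ (2 * N - 1 - a + 1)" using that N
      by (intro relpow_add_I[OF box_arc edge]) (auto simp: box_def box_adj_def)
    moreover have "2 * N - 1 - a + 1 = 2 * N - a" using that by simp
    ultimately show ?thesis by metis
  qed
  have yx: "(y, x) \<in> ?K" using xy sym_box by (auto dest: symD)
  have "y < 2 * N + 2" using box_bounds[OF _ xy(1)] N by simp
  \<comment> \<open>The walk is the rest of a face, of length \<open>N + 2 - 2\<close>. At a branch
    vertex \<open>y\<close> the three pairs of neighbours select the three faces meeting there; any
    other \<open>y\<close> has only one pair.\<close>
  then show ?thesis
  proof (cases rule: box_vertex_cases)
    case 1
    then consider "x = 1" "z = 2 * N - 1" | "x = 1" "z = 2 * N" | "x = 2 * N - 1" "z = 2 * N"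
      using yx xy lt N by auto
    then show ?thesis
    proof cases
      case 1
      have "(1, 2 * N + 1) \<in> ?K ^^ 1" by (rule edge) (use N in simp)+
      moreover have "(2 * N + 1, N + 1) \<in> ?K ^^ 1" by (rule edge) (use N in simp)+
      moreover have "(N + 1, 2 * N - 1) \<in> ?K ^^ (2 * N - 1 - (N + 1))" by (rule box_arc) (use N in simp)+
      ultimately have "(1, 2 * N - 1) \<in> ?K ^^ (1 + (1 + (2 * N - 1 - (N + 1))))"
        by (blast intro: relpow_add_I)
      moreover have "(1 + (1 + (2 * N - 1 - (N + 1)))) = N" using N by simp
      ultimately show ?thesis using 1 by metis
    next
      case 2
      have "(1, N) \<in> ?K ^^ (N - 1)" by (rule box_arc) (use N in simp)+
      moreover have "(N, 2 * N) \<in> ?K ^^ 1" by (rule edge) (use N in simp)+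
      ultimately have "(1, 2 * N) \<in> ?K ^^ (N - 1 + 1)" by (blast intro: relpow_add_I)
      moreover have "(N - 1 + 1) = N" using N by simp
      ultimately show ?thesis using 2 by metis
    next
      case 3
      have "(2 * N - 1, N) \<in> ?K ^^ (2 * N - 1 - N)" by (rule box_arc') (use N in simp)+
      moreover have "(N, 2 * N) \<in> ?K ^^ 1" by (rule edge) (use N in simp)+
      ultimately have "(2 * N - 1, 2 * N) \<in> ?K ^^ (2 * N - 1 - N + 1)" by (blast intro: relpow_add_I)
      moreover have "(2 * N - 1 - N + 1) = N" using N by simp
      ultimately show ?thesis using 3 by metis
    qed
  next
    case 2
    then consider "x = 0" "z = 2" | "x = 0" "z = 2 * N + 1" | "x = 2" "z = 2 * N + 1"
      using yx xy lt N by auto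
    then show ?thesis
    proof cases
      case 1
      have "(0, 2 * N) \<in> ?K ^^ 1" by (rule edge) (use N in simp)+
      moreover have "(2 * N, N) \<in> ?K ^^ 1" by (rule edge) (use N in simp)+
      moreover have "(N, 2) \<in> ?K ^^ (N - 2)" by (rule box_arc') (use N in simp)+
      ultimately have "(0, 2) \<in> ?K ^^ (1 + (1 + (N - 2)))" by (blast intro: relpow_add_I)
      moreover have "(1 + (1 + (N - 2))) = N" using N by simp
      ultimately show ?thesis using 1 by metis
    next
      case 2
      have "(2 * N + 1, N + 1) \<in> ?K ^^ 1" by (rule edge) (use N in simp)+
      moreover have "(N + 1, 0) \<in> ?K ^^ (2 * N - (N + 1))" by (rule wrap) (use N in simp)+
      ultimately have "(2 * N + 1, 0) \<in> ?K ^^ (1 + (2 * N - (N + 1)))" by (blast intro: relpow_add_I)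
      moreover have "(1 + (2 * N - (N + 1))) = N" using N by simp
      ultimately show ?thesis using 2 by metis
    next
      case 3
      have "(2, N + 1) \<in> ?K ^^ (N + 1 - 2)" by (rule box_arc) (use N in simp)+
      moreover have "(N + 1, 2 * N + 1) \<in> ?K ^^ 1" by (rule edge) (use N in simp)+
      ultimately have "(2, 2 * N + 1) \<in> ?K ^^ (N + 1 - 2 + 1)" by (blast intro: relpow_add_I)
      moreover have "(N + 1 - 2 + 1) = N" using N by simp
      ultimately show ?thesis using 3 by metis
    qed
  next
    case 3
    then consider "x = N - 1" "z = N + 1" | "x = N - 1" "z = 2 * N" | "x = N + 1" "z = 2 * N"
      using yx xy lt N by auto
    then show ?thesis
    proof cases
      case 1
      have "(N - 1, 1) \<in> ?K ^^ (N - 1 - 1)" by (rule box_arc') (use N in simp)+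
      moreover have "(1, 2 * N + 1) \<in> ?K ^^ 1" by (rule edge) (use N in simp)+
      moreover have "(2 * N + 1, N + 1) \<in> ?K ^^ 1" by (rule edge) (use N in simp)+
      ultimately have "(N - 1, N + 1) \<in> ?K ^^ (N - 1 - 1 + (1 + 1))" by (blast intro: relpow_add_I)
      moreover have "(N - 1 - 1 + (1 + 1)) = N" using N by simp
      ultimately show ?thesis using 1 by metis
    next
      case 2
      have "(N - 1, 0) \<in> ?K ^^ (N - 1 - 0)" by (rule box_arc') (use N in simp)+
      moreover have "(0, 2 * N) \<in> ?K ^^ 1" by (rule edge) (use N in simp)+
      ultimately have "(N - 1, 2 * N) \<in> ?K ^^ (N - 1 - 0 + 1)" by (blast intro: relpow_add_I)
      moreover have "(N - 1 - 0 + 1) = N" using N by simp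
      ultimately show ?thesis using 2 by metis
    next
      case 3
      have "(N + 1, 0) \<in> ?K ^^ (2 * N - (N + 1))" by (rule wrap) (use N in simp)+
      moreover have "(0, 2 * N) \<in> ?K ^^ 1" by (rule edge) (use N in simp)+
      ultimately have "(N + 1, 2 * N) \<in> ?K ^^ (2 * N - (N + 1) + 1)" by (blast intro: relpow_add_I)
      moreover have "(2 * N - (N + 1) + 1) = N" using N by simp
      ultimately show ?thesis using 3 by metis
    qed
  next
    case 4
    then consider "x = N" "z = N + 2" | "x = N" "z = 2 * N + 1" | "x = N + 2" "z = 2 * N + 1"
      using yx xy lt N by auto
    then show ?thesis
    proof cases
      case 1
      have "(N + 2, 0) \<in> ?K ^^ (2 * N - (N + 2))" by (rule wrap) (use N in simp)+
      moreover have "(0, 2 * N) \<in> ?K ^^ 1" by (rule edge) (use N in simp)+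
      moreover have "(2 * N, N) \<in> ?K ^^ 1" by (rule edge) (use N in simp)+
      ultimately have "(N + 2, N) \<in> ?K ^^ (2 * N - (N + 2) + (1 + 1))" by (blast intro: relpow_add_I)
      moreover have "(2 * N - (N + 2) + (1 + 1)) = N" using N by simp
      ultimately show ?thesis using 1 by metis
    next
      case 2
      have "(N, 1) \<in> ?K ^^ (N - 1)" by (rule box_arc') (use N in simp)+
      moreover have "(1, 2 * N + 1) \<in> ?K ^^ 1" by (rule edge) (use N in simp)+
      ultimately have "(N, 2 * N + 1) \<in> ?K ^^ (N - 1 + 1)" by (blast intro: relpow_add_I)
      moreover have "(N - 1 + 1) = N" using N by simp
      ultimately show ?thesis using 2 by metis
    next
      case 3
      have "(N + 2, 0) \<in> ?K ^^ (2 * N - (N + 2))" by (rule wrap) (use N in simp)+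
      moreover have "(0, 1) \<in> ?K ^^ 1" by (rule edge) (use N in simp)+
      moreover have "(1, 2 * N + 1) \<in> ?K ^^ 1" by (rule edge) (use N in simp)+
      ultimately have "(N + 2, 2 * N + 1) \<in> ?K ^^ (2 * N - (N + 2) + (1 + 1))" by (blast intro: relpow_add_I)
      moreover have "(2 * N - (N + 2) + (1 + 1)) = N" using N by simp
      ultimately show ?thesis using 3 by metis
    qed
  next
    case 5
    then have "x = 0" "z = N" using yx xy lt by auto
    then show ?thesis using box_arc[of 0 N N] N by simp
  next
    case 6
    then have "x = 1" "z = N + 1" using yx xy lt N by auto
    then show ?thesis using box_arc[of 1 "N + 1" N] N by simp
  next
    case 7
    then have xz: "x = y - 1" "z = y + 1" using yx xy lt N by (auto simp: box_nbrs_arc)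
    have "(z, N) \<in> ?K ^^ (N - z)" by (rule box_arc) (use N 7 xz in simp)+
    moreover have "(N, 2 * N) \<in> ?K ^^ 1" by (rule edge) (use N 7 xz in simp)+
    moreover have "(2 * N, 0) \<in> ?K ^^ 1" by (rule edge) (use N 7 xz in simp)+
    moreover have "(0, x) \<in> ?K ^^ (x - 0)" by (rule box_arc) (use N 7 xz in simp)+
    ultimately have "(z, x) \<in> ?K ^^ (N - z + (1 + (1 + (x - 0))))" by (blast intro: relpow_add_I)
    moreover have "N - z + (1 + (1 + (x - 0))) = N" using xz 7 N by simp
    ultimately show ?thesis by metis
  next
    case 8
    then have xz: "x = y - 1" "z = y + 1" using yx xy lt N by (auto simp: box_nbrs_arc)
    have "(z, 0) \<in> ?K ^^ (2 * N - z)" by (rule wrap) (use N 8 xz in simp)+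
    moreover have "(0, 2 * N) \<in> ?K ^^ 1" by (rule edge) (use N 8 xz in simp)+
    moreover have "(2 * N, N) \<in> ?K ^^ 1" by (rule edge) (use N 8 xz in simp)+
    moreover have "(N, x) \<in> ?K ^^ (x - N)" by (rule box_arc) (use N 8 xz in simp)+
    ultimately have "(z, x) \<in> ?K ^^ (2 * N - z + (1 + (1 + (x - N))))" by (blast intro: relpow_add_I)
    moreover have "2 * N - z + (1 + (1 + (x - N))) = N" using xz 8 N by simp
    ultimately show ?thesis by metis
  next
    case 9
    then have xz: "x = 0" "z = 2 * N - 2" using yx xy lt N by auto
    have "(0, 2 * N) \<in> ?K ^^ 1" by (rule edge) (use N xz in simp)+
    moreover have "(2 * N, N) \<in> ?K ^^ 1" by (rule edge) (use N xz in simp)+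
    moreover have "(N, z) \<in> ?K ^^ (z - N)" by (rule box_arc) (use N xz in simp)+
    ultimately have "(x, z) \<in> ?K ^^ (1 + (1 + (z - N)))" unfolding xz(1) by (blast intro: relpow_add_I)
    moreover have "1 + (1 + (z - N)) = N" using xz N by simp
    ultimately show ?thesis by metis
  qed
qed

lemma box_close_path:
  assumes N: "N \<ge> 5" and xy: "(x, y) \<in> box N" "(y, z) \<in> box N" "x \<noteq> z"
  shows "(x, z) \<in> box N ^^ N"
proof -
  have yx: "(z, y) \<in> box N" "(y, x) \<in> box N" using xy sym_box by (auto dest: symD)
  consider "x < z" | "z < x" using \<open>x \<noteq> z\<close> by linarith
  then show ?thesis
  proof cases
    case 1
    from box_close_path_less[OF N xy(1,2) 1] show ?thesis by (meson sym_relpow sym_box)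
  next
    case 2
    from box_close_path_less[OF N yx 2] show ?thesis by (meson sym_relpow sym_box)
  qed
qed

section \<open>Lower bound for odd closed walks of the box graph\<close>

text \<open>The bipartite double cover of the graph is the 1-skeleton of the box
  \<open>[0, 1] \<times> [0, 2] \<times> [0, N - 1]\<close> subdivided at the lattice points; its deck transformation is the
  antipodal map. The coordinates below lift each vertex to the box.\<close>

definition box_x :: "nat \<Rightarrow> nat \<Rightarrow> int" where
  "box_x N v = (if v = 0 \<or> v = N \<or> v = 2 * N then 0 else 1)"

definition box_y :: "nat \<Rightarrow> nat \<Rightarrow> int" where
  "box_y N v = (if v < N then 0 else if v < 2 * N then 2 else 1)"

definition box_z :: "nat \<Rightarrow> nat \<Rightarrow> int" where
  "box_z N v = (if v = 0 \<or> v = N \<or> v \<ge> 2 * N then 0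
     else if v < N then int v - 1 else int v - int N - 1)"

definition box_dist :: "nat \<Rightarrow> nat \<Rightarrow> nat \<Rightarrow> int" where
  "box_dist N u v = \<bar>box_x N u - box_x N v\<bar> + \<bar>box_y N u - box_y N v\<bar> + \<bar>box_z N u - box_z N v\<bar>"

text \<open>The L1 distance from the lift of \<open>u\<close> to the antipode
  \<open>(1 - x, 2 - y, N - 1 - z)\<close> of the lift of \<open>v\<close>; \<open>box_dist\<close>
  is that of the lifts themselves.\<close>

definition box_antidist :: "nat \<Rightarrow> nat \<Rightarrow> nat \<Rightarrow> int" where
  "box_antidist N u v = \<bar>box_x N u + box_x N v - 1\<bar> + \<bar>box_y N u + box_y N v - 2\<bar>
     + \<bar>box_z N u + box_z N v - (int N - 1)\<bar>"

text \<open>An edge lifts to a unit step from the lift of \<open>v\<close>. It ends at the chosen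
  lift of \<open>w\<close>, except for the edges \<open>{N - 1, N}\<close> and
  \<open>{0, 2 * N - 1}\<close>, where it ends at the antipode.\<close>

lemma box_adj_dist:
  assumes N: "N \<ge> 5" and vw: "box_adj N v w"
  shows "box_dist N v w = 1 \<or> box_antidist N v w = 1"
proof -
  note defs = box_dist_def box_antidist_def box_x_def box_y_def box_z_def
  from vw show ?thesis
  proof (cases rule: box_adj_cases)
    case arc: 1
    have "v = 0 \<or> 0 < v \<and> v < N - 1 \<or> v = N - 1 \<or> v = N \<or> N < v" by linarith
    then consider (1) "v = 0" | (2) "0 < v" "v < N - 1" | (3) "v = N - 1" | (4) "v = N" | (5) "N < v"
      by blast
    then show ?thesis
    proof cases
    case 1
    then have "box_dist N v w = 1" using N arc unfolding defs by auto
    then show ?thesis ..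
  next
    case 2
    then have "box_dist N v w = 1" using N arc unfolding defs by auto
    then show ?thesis ..
  next
    case 3
    then have "box_antidist N v w = 1" using N arc unfolding defs by auto
    then show ?thesis ..
  next
    case 4
    then have "box_dist N v w = 1" using N arc unfolding defs by auto
    then show ?thesis ..
  next
    case 5
    then have "box_dist N v w = 1" using N arc unfolding defs by auto
    then show ?thesis ..
    qed
  next
    case 2
    have "box_antidist N v w = 1" using N unfolding defs 2 by auto
    then show ?thesis ..
  next
    case 3
    have "box_dist N v w = 1" using N unfolding defs 3 by auto
    then show ?thesis ..
  next
    case 4
    have "box_dist N v w = 1" using N unfolding defs 4 by auto
    then show ?thesis ..
  next
    case 5
    have "box_dist N v w = 1" using N unfolding defs 5 by auto
    then show ?thesis ..
  next
    case 6
    have "box_dist N v w = 1" using N unfolding defs 6 by auto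
    then show ?thesis ..
  qed
qed

lemma box_dist_commute: "box_dist N u v = box_dist N v u"
  unfolding box_dist_def
  by (simp only: abs_minus_commute[of "box_x N u"] abs_minus_commute[of "box_y N u"]
      abs_minus_commute[of "box_z N u"])

lemma box_antidist_commute: "box_antidist N u v = box_antidist N v u"
  unfolding box_antidist_def
  by (simp only: add.commute[of "box_x N u" "box_x N v"] add.commute[of "box_y N u" "box_y N v"]
      add.commute[of "box_z N u" "box_z N v"])

lemma even_abs_add: "even (\<bar>a\<bar> + b) \<longleftrightarrow> even (a + b)" for a b :: int
  by (auto simp: abs_if)

definition box_sum :: "nat \<Rightarrow> nat \<Rightarrow> int" where
  "box_sum N v = box_x N v + box_y N v + box_z N v"

lemma box_dist_parity: "even (box_dist N u v) \<longleftrightarrow> even (box_sum N u + box_sum N v)"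
  unfolding box_dist_def box_sum_def by (simp add: even_abs_add) blast

text \<open>Modulo 2 the antipodal map shifts the coordinate sum by \<open>N + 2\<close>, so for odd
  \<open>N\<close> it swaps the two classes of the bipartite cover.\<close>

lemma box_antidist_parity:
  "odd N \<Longrightarrow> even (box_antidist N u v) \<longleftrightarrow> odd (box_sum N u + box_sum N v)"
  unfolding box_antidist_def box_sum_def by (simp add: even_abs_add) blast

lemma sum3_le:
  fixes a a' a'' b b' b'' c c' c'' :: int
  assumes "c + c' + c'' = 1" "a \<le> b + c" "a' \<le> b' + c'" "a'' \<le> b'' + c''"
  shows "a + a' + a'' \<le> b + b' + b'' + 1"
  using assms by linarith

text \<open>Triangle inequality, one coordinate at a time; the antipodal map is an isometry, so an
  edge of the second kind just exchanges the two distances.\<close>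

lemma box_dist_step:
  "box_dist N v w = 1 \<Longrightarrow> box_dist N u w \<le> box_dist N u v + 1"
  "box_dist N v w = 1 \<Longrightarrow> box_antidist N u w \<le> box_antidist N u v + 1"
  "box_antidist N v w = 1 \<Longrightarrow> box_dist N u w \<le> box_antidist N u v + 1"
  "box_antidist N v w = 1 \<Longrightarrow> box_antidist N u w \<le> box_dist N u v + 1"
  unfolding box_dist_def box_antidist_def
  by - (erule sum3_le; linarith)+

lemma box_dist_step_parity:
  assumes "odd N"
  shows "box_dist N v w = 1 \<Longrightarrow> even (box_dist N u w) \<longleftrightarrow> odd (box_dist N u v)"
    "box_dist N v w = 1 \<Longrightarrow> even (box_antidist N u w) \<longleftrightarrow> odd (box_antidist N u v)"
    "box_antidist N v w = 1 \<Longrightarrow> even (box_dist N u w) \<longleftrightarrow> odd (box_antidist N u v)"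
    "box_antidist N v w = 1 \<Longrightarrow> even (box_antidist N u w) \<longleftrightarrow> odd (box_dist N u v)"
  using box_dist_parity[of N v w] box_antidist_parity[OF assms, of v w]
  by (auto simp: box_dist_parity box_antidist_parity[OF assms])

text \<open>Lift the walk to the box, starting at the lift of \<open>u\<close>. It ends at the lift
  of \<open>v\<close> or at its antipode, and each unit step changes the parity of the L1 distance
  from the start.\<close>

lemma box_walk_dist:
  assumes N: "N \<ge> 5" "odd N" and "(u, v) \<in> box N ^^ k"
  shows "box_dist N u v \<le> int k \<and> even (box_dist N u v + int k) \<or>
    box_antidist N u v \<le> int k \<and> even (box_antidist N u v + int k)"
  using assms(3)
proof (induction k arbitrary: v)
  case 0
  then show ?case by (simp add: box_dist_def)
next
  case (Suc k)
  then obtain w where w: "(u, w) \<in> box N ^^ k" "(w, v) \<in> box N" by auto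
  then have "box_adj N w v \<or> box_adj N v w" unfolding box_def by simp
  then have "box_dist N w v = 1 \<or> box_antidist N w v = 1"
    by (metis box_adj_dist[OF N(1)] box_dist_commute box_antidist_commute)
  then show ?case
  proof
    assume 1: "box_dist N w v = 1"
    show ?thesis
      using Suc.IH[OF w(1)] box_dist_step(1,2)[OF 1, of u] box_dist_step_parity(1,2)[OF N(2) 1, of u]
      by auto
  next
    assume 1: "box_antidist N w v = 1"
    show ?thesis
      using Suc.IH[OF w(1)] box_dist_step(3,4)[OF 1, of u] box_dist_step_parity(3,4)[OF N(2) 1, of u]
      by auto
  qed
qed

text \<open>By parity the lift of an odd closed walk ends at the antipode of its start, and opposite
  corners of the box are \<open>1 + 2 + (N - 1)\<close> apart.\<close>

lemma box_no_short_odd_corner: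
  assumes N: "N \<ge> 5" "odd N" and "(u, u) \<in> box N ^^ k" "odd k" "u \<in> {0, 1, N, N + 1}"
  shows "k \<ge> N + 2"
proof -
  have "box_antidist N u u = int N + 2"
  proof -
    have "box_x N u = 0 \<or> box_x N u = 1" "box_y N u = 0 \<or> box_y N u = 2" "box_z N u = 0"
      using N(1) assms(5) unfolding box_x_def box_y_def box_z_def by auto
    then show ?thesis using N(1) unfolding box_antidist_def by auto
  qed
  moreover have "box_dist N u u = 0" unfolding box_dist_def by simp
  ultimately show ?thesis using box_walk_dist[OF N assms(3)] \<open>odd k\<close> by auto
qed

text \<open>Away from the corners the distance bound is too weak: the midpoint of a long side is
  close to its antipode. But the edges that avoid the branch vertices join consecutive numbers and
  so form a bipartite graph. Hence an odd closed walk meets a branch vertex and can be rotated to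
  start there.\<close>

lemma box_no_short_odd:
  assumes N: "N \<ge> 5" "odd N" and u: "(u, u) \<in> box N ^^ k" "odd k"
  shows "k \<ge> N + 2"
proof -
  let ?E = "{(a, b). a \<in> {0, 1, N, N + 1} \<or> b \<in> {0, 1, N, N + 1}}"
  have step: "odd (v + w)" if "(v, w) \<in> box N - ?E" for v w
    using that by (auto simp: box_def box_adj_def)
  have "even (v + w + j)" if "(v, w) \<in> (box N - ?E) ^^ j" for v w j
    using that
  proof (induction j arbitrary: w)
    case (Suc j)
    then obtain w' where "(v, w') \<in> (box N - ?E) ^^ j" "(w', w) \<in> box N - ?E" by auto
    then show ?case using Suc.IH[of w'] step[of w' w] by (auto simp: even_add)
  qed auto
  from this[of u u k] have "(u, u) \<notin> (box N - ?E) ^^ k" using \<open>odd k\<close> by auto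
  with relpow_avoid[OF u(1), of ?E] obtain s t a b where
    ab: "(a, b) \<in> box N" "a \<in> {0, 1, N, N + 1} \<or> b \<in> {0, 1, N, N + 1}"
    and st: "(u, a) \<in> box N ^^ s" "(b, u) \<in> box N ^^ t" "s + t + 1 = k"
    by blast
  have e: "(a, b) \<in> box N ^^ 1" using ab by simp
  have "(a, a) \<in> box N ^^ (1 + (t + s))" "(b, b) \<in> box N ^^ (t + (s + 1))"
    using relpow_add_I[OF e relpow_add_I[OF st(2,1)]]
      relpow_add_I[OF st(2) relpow_add_I[OF st(1) e]] by blast+
  moreover have "1 + (t + s) = k" "t + (s + 1) = k" using st by simp_all
  ultimately have "(a, a) \<in> box N ^^ k" "(b, b) \<in> box N ^^ k" by metis+
  then show ?thesis using box_no_short_odd_corner[OF N _ \<open>odd k\<close>] ab(2) by blast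
qed

section \<open>Locally injective endomorphisms of the box graph\<close>

definition box_endo :: "nat \<Rightarrow> (nat \<Rightarrow> nat) \<Rightarrow> bool" where
  "box_endo N f \<longleftrightarrow> (\<forall>x y. (x, y) \<in> box N \<longrightarrow> (f x, f y) \<in> box N) \<and>
    (\<forall>x y z. (x, y) \<in> box N \<longrightarrow> (y, z) \<in> box N \<longrightarrow> x \<noteq> z \<longrightarrow> f x \<noteq> f z)"

text \<open>On the branch vertices this and \<open>box_refl\<close> are double transpositions; this
  one fixes both middle vertices, \<open>box_refl\<close> swaps them.\<close>

definition box_rot :: "nat \<Rightarrow> nat \<Rightarrow> nat" where
  "box_rot N x = (if x < N then x + N else if x < 2 * N then x - N else x)"

definition box_refl :: "nat \<Rightarrow> nat \<Rightarrow> nat" where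
  "box_refl N x = (if x \<le> 1 then 1 - x else if x < 2 * N then 2 * N + 1 - x
     else if x = 2 * N then 2 * N + 1 else 2 * N)"

lemma box_branch:
  assumes N: "N \<ge> 5" and "(y, a) \<in> box N" "(y, b) \<in> box N" "(y, c) \<in> box N"
    and "a \<noteq> b" "a \<noteq> c" "b \<noteq> c"
  shows "y \<in> {0, 1, N, N + 1}"
proof -
  have "y < 2 * N + 2" using box_bounds[OF _ assms(2)] N by simp
  then show ?thesis
  proof (cases rule: box_vertex_cases)
    case 5
    then show ?thesis using assms box_nbrs(5)[OF N] by metis
  next
    case 6
    then show ?thesis using assms box_nbrs(6)[OF N] by metis
  next
    case 7
    then show ?thesis using assms box_nbrs_arc[of y N] by metis
  next
    case 8
    then show ?thesis using assms box_nbrs_arc[of y N] by metis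
  next
    case 9
    then show ?thesis using assms box_nbrs_last[OF N] by metis
  qed auto
qed

text \<open>With 0 and 1 fixed, a path of length 2 leaving one of them could at first only be turned
  into the path of length \<open>N - 1\<close>. But its other end must go to a branch vertex, and
  the vertex two steps along a path of length \<open>N - 1 > 2\<close> is none. Local injectivity
  then continues the identity along both arcs.\<close>

lemma box_endo_fixes:
  assumes N: "N \<ge> 5" and f: "box_endo N f" and f01: "f 0 = 0" "f 1 = 1" and x: "x < 2 * N + 2"
  shows "f x = x"
proof -
  have hom: "(f x, f y) \<in> box N" if "(x, y) \<in> box N" for x y
    using f that unfolding box_endo_def by blast
  have inj: "f x \<noteq> f z" if "(x, y) \<in> box N" "(y, z) \<in> box N" "x \<noteq> z" for x y z
    using f that unfolding box_endo_def by blast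
  note nb = box_nbrs[OF N] box_nbrs_last[OF N] box_nbrs_arc[of _ N]
  have sb: "(x, y) \<in> box N \<longleftrightarrow> (y, x) \<in> box N" for x y using sym_box by (auto dest: symD)
  have e: "(0, 1) \<in> box N" "(1, 0) \<in> box N" "(0, 2 * N) \<in> box N" "(0, 2 * N - 1) \<in> box N" "(2 * N, N) \<in> box N"
    "(1, 2) \<in> box N" "(1, 2 * N + 1) \<in> box N" "(2 * N + 1, N + 1) \<in> box N" "(2 * N, 0) \<in> box N"
    "(2 * N + 1, 1) \<in> box N" "(N, N + 1) \<in> box N" "(N + 1, N + 2) \<in> box N" "(N + 1, 2 * N + 1) \<in> box N"
    using nb by simp_all
  have br: "f N \<in> {0, 1, N, N + 1}" "f (N + 1) \<in> {0, 1, N, N + 1}"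
  proof -
    have "(N, N - 1) \<in> box N" "(N, N + 1) \<in> box N" "(N, 2 * N) \<in> box N" using nb by simp_all
    then show "f N \<in> {0, 1, N, N + 1}"
      using N hom inj sb by (intro box_branch[OF N, of _ "f (N - 1)" "f (N + 1)" "f (2 * N)"]) auto
    have "(N + 1, N) \<in> box N" "(N + 1, N + 2) \<in> box N" "(N + 1, 2 * N + 1) \<in> box N" using nb by simp_all
    then show "f (N + 1) \<in> {0, 1, N, N + 1}"
      using N hom inj sb by (intro box_branch[OF N, of _ "f N" "f (N + 2)" "f (2 * N + 1)"]) auto
  qed
  have m: "f (2 * N) = 2 * N"
  proof (rule ccontr)
    assume *: "f (2 * N) \<noteq> 2 * N"
    have "(0, f (2 * N)) \<in> box N" using hom[OF e(3)] f01 by simp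
    moreover have "f (2 * N) \<noteq> 1" using inj[OF e(2,3)] f01 N by simp
    ultimately have *: "f (2 * N) = 2 * N - 1" using * by (metis nb(1))
    have "(2 * N - 1, f N) \<in> box N" using hom[OF e(5)] * by simp
    moreover have "f N \<noteq> 0" using inj[OF e(3,5)] f01 N by simp
    ultimately have "f N = 2 * N - 2" by (metis box_nbrs_last[OF N])
    with br(1) have "2 * N - 2 \<in> {0, 1, N, N + 1}" by simp
    then show False using N by (elim insertE emptyE) linarith+
  qed
  have m': "f (2 * N + 1) = 2 * N + 1"
  proof (rule ccontr)
    assume *: "f (2 * N + 1) \<noteq> 2 * N + 1"
    have "(1, f (2 * N + 1)) \<in> box N" using hom[OF e(7)] f01 by simp
    moreover have "f (2 * N + 1) \<noteq> 0" using inj[OF e(1,7)] f01 N by simp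
    ultimately have *: "f (2 * N + 1) = 2" using * by (metis nb(2))
    have "(2, f (N + 1)) \<in> box N" using hom[OF e(8)] * by simp
    moreover have "f (N + 1) \<noteq> 1" using inj[OF e(7,8)] f01 N by simp
    ultimately have "f (N + 1) = 3" using box_nbrs_arc[of 2 N] N by simp
    with br(2) show False using N by simp
  qed
  have two: "f 2 = 2"
  proof -
    have "(1, f 2) \<in> box N" using hom[OF e(6)] f01 by simp
    moreover have "f 2 \<noteq> 0" using inj[OF e(1,6)] f01 N by simp
    moreover have "f 2 \<noteq> 2 * N + 1" using inj[OF e(10,6)] m' N by simp
    ultimately show ?thesis by (metis nb(2))
  qed
  have fN: "f N = N"
  proof -
    have "(2 * N, f N) \<in> box N" using hom[OF e(5)] m by simp
    moreover have "f N \<noteq> 0" using inj[OF e(3,5)] f01 N by simp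
    ultimately show ?thesis by (metis nb(5))
  qed
  have fN1: "f (N + 1) = N + 1"
  proof -
    have "(2 * N + 1, f (N + 1)) \<in> box N" using hom[OF e(8)] m' by simp
    moreover have "f (N + 1) \<noteq> 1" using inj[OF e(7,8)] f01 N by simp
    ultimately show ?thesis by (metis nb(6))
  qed
  have fN2: "f (N + 2) = N + 2"
  proof -
    have "(N + 1, f (N + 2)) \<in> box N" using hom[OF e(12)] fN1 by simp
    moreover have "f (N + 2) \<noteq> N" using inj[OF e(11,12)] fN N by simp
    moreover have "f (N + 2) \<noteq> 2 * N + 1" using inj[OF e(8,12)] m' N by simp
    ultimately show ?thesis by (metis nb(4))
  qed
  have step: "f (y + 1) = y + 1"
    if y: "2 \<le> y \<and> y < N \<or> N + 2 \<le> y \<and> y < 2 * N - 1" "f (y - 1) = y - 1" "f y = y" for y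
  proof -
    have "(y, y - 1) \<in> box N" and 2: "(y, y + 1) \<in> box N"
      by (simp_all add: box_nbrs_arc[OF y(1)])
    then have *: "(y - 1, y) \<in> box N" "(y, y + 1) \<in> box N"
      using sb by metis+
    have "(y, f (y + 1)) \<in> box N" using hom[OF *(2)] y(3) by simp
    moreover have "f (y + 1) \<noteq> y - 1"
    proof -
      have "y - 1 \<noteq> y + 1" by linarith
      from inj[OF * this] show ?thesis using y(2) by simp
    qed
    ultimately show ?thesis by (metis box_nbrs_arc[OF y(1)])
  qed
  have arc1: "i + 2 \<le> N \<Longrightarrow> f (i + 1) = i + 1 \<and> f (i + 2) = i + 2" for i
  proof (induction i)
    case (Suc i)
    then show ?case using step[of "i + 2"] by simp
  qed (use f01 two in \<open>simp add: numeral_2_eq_2\<close>)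
  have arc2: "N + i + 2 \<le> 2 * N - 1 \<Longrightarrow> f (N + i + 1) = N + i + 1 \<and> f (N + i + 2) = N + i + 2" for i
  proof (induction i)
    case (Suc i)
    then show ?case using step[of "N + i + 2"] by simp
  qed (use fN1 fN2 in simp)
  from x show ?thesis
  proof (cases rule: box_vertex_cases)
    case 7
    then show ?thesis using arc1[of "x - 1"] by simp
  next
    case 8
    then show ?thesis using arc2[of "x - N - 1"] by simp
  next
    case 9
    then have "N + (N - 3) + 2 = x" "N + (N - 3) + 2 \<le> 2 * N - 1" using N by linarith+
    then show ?thesis using arc2[of "N - 3"] by metis
  qed (use f01 fN fN1 m m' in auto)
qed

lemma box_rot_rot: "x < 2 * N + 2 \<Longrightarrow> box_rot N (box_rot N x) = x"
  unfolding box_rot_def by auto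

lemma box_refl_refl: "N \<ge> 5 \<Longrightarrow> x < 2 * N + 2 \<Longrightarrow> box_refl N (box_refl N x) = x"
  unfolding box_refl_def by auto

lemma box_adj_rot:
  assumes N: "N \<ge> 5" and "box_adj N x y"
  shows "(box_rot N x, box_rot N y) \<in> box N"
  using assms(2)
proof (cases rule: box_adj_cases)
  case 1
  then consider "x < N - 1" | "x = N - 1" | "N \<le> x" by linarith
  then show ?thesis
  proof cases
    case a: 1
    then have "box_rot N x = x + N" "box_rot N y = Suc (x + N)" "Suc (x + N) < 2 * N"
      using 1 by (simp_all add: box_rot_def)
    then show ?thesis by (simp add: box_def box_adj_def)
  next
    case 2
    then have "box_rot N x = 2 * N - 1" "box_rot N y = 0"
      using 1 N by (simp_all add: box_rot_def)
    then show ?thesis by (simp add: box_def box_adj_def)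
  next
    case 3
    then have "box_rot N x = x - N" "box_rot N y = Suc (x - N)" "Suc (x - N) < 2 * N"
      using 1 by (simp_all add: box_rot_def Suc_diff_le)
    then show ?thesis by (simp add: box_def box_adj_def)
  qed
next
  case 2
  then have "box_rot N x = N" "box_rot N y = N - 1" using N by (simp_all add: box_rot_def)
  then show ?thesis using box_nbrs(3)[OF N] by simp
next
  case 3
  then have "box_rot N x = N" "box_rot N y = 2 * N" using N by (simp_all add: box_rot_def)
  then show ?thesis using box_nbrs(3)[OF N] by simp
next
  case 4
  then have "box_rot N x = 0" "box_rot N y = 2 * N" using N by (simp_all add: box_rot_def)
  then show ?thesis using box_nbrs(1)[OF N] by simp
next
  case 5
  then have "box_rot N x = N + 1" "box_rot N y = 2 * N + 1" using N by (simp_all add: box_rot_def)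
  then show ?thesis using box_nbrs(4)[OF N] by simp
next
  case 6
  then have "box_rot N x = 1" "box_rot N y = 2 * N + 1" using N by (simp_all add: box_rot_def)
  then show ?thesis using box_nbrs(2)[OF N] by simp
qed

lemma box_adj_refl:
  assumes N: "N \<ge> 5" and "box_adj N x y"
  shows "(box_refl N x, box_refl N y) \<in> box N"
  using assms(2)
proof (cases rule: box_adj_cases)
  case 1
  then consider "x = 0" | "x = 1" | "2 \<le> x" by linarith
  then show ?thesis
  proof cases
    case 1
    then show ?thesis using \<open>y = Suc x\<close> N by (simp add: box_def box_adj_def box_refl_def)
  next
    case 2
    then show ?thesis using \<open>y = Suc x\<close> N by (simp add: box_def box_adj_def box_refl_def)
  next
    case 3
    have "box_refl N x = Suc (box_refl N y)" "box_refl N x < 2 * N"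
      using 1 3 by (auto simp: box_refl_def)
    then show ?thesis by (simp add: box_def box_adj_def)
  qed
next
  case 2
  then have "box_refl N x = 1" "box_refl N y = 2" using N by (simp_all add: box_refl_def)
  then show ?thesis using box_nbrs(2)[OF N] by simp
next
  case 3
  then have "box_refl N x = 1" "box_refl N y = 2 * N + 1" using N by (simp_all add: box_refl_def)
  then show ?thesis using box_nbrs(2)[OF N] by simp
next
  case 4
  then have "box_refl N x = N + 1" "box_refl N y = 2 * N + 1" using N by (simp_all add: box_refl_def)
  then show ?thesis using box_nbrs(4)[OF N] by simp
next
  case 5
  then have "box_refl N x = 0" "box_refl N y = 2 * N" using N by (simp_all add: box_refl_def)
  then show ?thesis using box_nbrs(1)[OF N] by simp
next
  case 6
  then have "box_refl N x = N" "box_refl N y = 2 * N" using N by (simp_all add: box_refl_def)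
  then show ?thesis using box_nbrs(3)[OF N] by simp
qed

lemma box_rot: "N \<ge> 5 \<Longrightarrow> (x, y) \<in> box N \<Longrightarrow> (box_rot N x, box_rot N y) \<in> box N"
  using box_adj_rot[of N x y] box_adj_rot[of N y x] sym_box[of N]
  by (auto simp: box_def[of N] dest: symD)

lemma box_refl: "N \<ge> 5 \<Longrightarrow> (x, y) \<in> box N \<Longrightarrow> (box_refl N x, box_refl N y) \<in> box N"
  using box_adj_refl[of N x y] box_adj_refl[of N y x] sym_box[of N]
  by (auto simp: box_def[of N] dest: symD)

lemma box_endo_comp:
  assumes N: "N \<ge> 5" and f: "box_endo N f" and s: "\<And>x y. (x, y) \<in> box N \<Longrightarrow> (s x, s y) \<in> box N"
    "\<And>x. x < 2 * N + 2 \<Longrightarrow> s (s x) = x"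
  shows "box_endo N (s \<circ> f)"
  unfolding box_endo_def
proof (intro conjI allI impI)
  show "((s \<circ> f) x, (s \<circ> f) y) \<in> box N" if "(x, y) \<in> box N" for x y
    using that f s(1) unfolding box_endo_def by simp
  fix x y z assume *: "(x, y) \<in> box N" "(y, z) \<in> box N" "x \<noteq> z"
  then have "(f x, f y) \<in> box N" "(f y, f z) \<in> box N" "f x \<noteq> f z"
    using f unfolding box_endo_def by metis+
  moreover have "f x < 2 * N + 2" "f z < 2 * N + 2"
    using box_bounds[OF _ calculation(1)] box_bounds[OF _ calculation(2)] N by simp_all
  ultimately show "(s \<circ> f) x \<noteq> (s \<circ> f) z"
    using s(2)[of "f x"] s(2)[of "f z"] by auto
qed

text \<open>The arc \<open>(0, 1)\<close> goes to an arc between branch vertices, of which there are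
  four. For each, one group element carries it back to \<open>(0, 1)\<close>, and after composing
  with it \<open>box_endo_fixes\<close> applies.\<close>

theorem box_endo_cases:
  assumes N: "N \<ge> 5" and f: "box_endo N f"
  obtains s where "s \<in> {id, box_rot N, box_refl N, box_rot N \<circ> box_refl N}"
    "\<And>x. x < 2 * N + 2 \<Longrightarrow> f x = s x"
proof -
  have hom: "(f x, f y) \<in> box N" if "(x, y) \<in> box N" for x y
    using f that unfolding box_endo_def by blast
  have inj: "f x \<noteq> f z" if "(y, x) \<in> box N" "(y, z) \<in> box N" "x \<noteq> z" for x y z
    using f that sym_box unfolding box_endo_def by (metis symD)
  have bound: "f x < 2 * N + 2" if "x < 2 * N + 2" for x
  proof -
    from that have "\<exists>y. (x, y) \<in> box N"
    proof (cases rule: box_vertex_cases)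
      case 7
      then show ?thesis using box_nbrs_arc[of x N] by blast
    next
      case 8
      then show ?thesis using box_nbrs_arc[of x N] by blast
    qed (use box_nbrs[OF N] box_nbrs_last[OF N] in blast)+
    then show ?thesis using hom box_bounds[of N "f x"] N by fastforce
  qed
  have br: "f 0 \<in> {0, 1, N, N + 1}" "f 1 \<in> {0, 1, N, N + 1}"
  proof -
    have *: "(0, 1) \<in> box N" "(0, 2 * N - 1) \<in> box N" "(0, 2 * N) \<in> box N"
      using box_nbrs(1)[OF N] by simp_all
    show "f 0 \<in> {0, 1, N, N + 1}"
      by (rule box_branch[OF N hom[OF *(1)] hom[OF *(2)] hom[OF *(3)] inj[OF *(1,2)] inj[OF *(1,3)] inj[OF *(2,3)]])
        (use N in simp_all)
    have *: "(1, 0) \<in> box N" "(1, 2) \<in> box N" "(1, 2 * N + 1) \<in> box N"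
      using box_nbrs(2)[OF N] by simp_all
    show "f 1 \<in> {0, 1, N, N + 1}"
      by (rule box_branch[OF N hom[OF *(1)] hom[OF *(2)] hom[OF *(3)] inj[OF *(1,2)] inj[OF *(1,3)] inj[OF *(2,3)]])
        (use N in simp_all)
  qed
  have "(f 0, f 1) \<in> box N" using hom box_nbrs(1)[OF N] by simp
  note f01 = this
  from br(1) consider "f 0 = 0" "f 1 = 1" | "f 0 = 1" "f 1 = 0" | "f 0 = N" "f 1 = N + 1"
    | "f 0 = N + 1" "f 1 = N"
  proof (elim insertE emptyE)
    assume *: "f 0 = 0"
    then have "f 1 = 1 \<or> f 1 = 2 * N - 1 \<or> f 1 = 2 * N" using f01 box_nbrs(1)[OF N] by simp
    with br(2) have "f 1 = 1" using N by (elim disjE insertE emptyE) linarith+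
    with * show ?thesis using that by blast
  next
    assume *: "f 0 = 1"
    then have "f 1 = 0 \<or> f 1 = 2 \<or> f 1 = 2 * N + 1" using f01 box_nbrs(2)[OF N] by simp
    with br(2) have "f 1 = 0" using N by (elim disjE insertE emptyE) linarith+
    with * show ?thesis using that by blast
  next
    assume *: "f 0 = N"
    then have "f 1 = N - 1 \<or> f 1 = N + 1 \<or> f 1 = 2 * N" using f01 box_nbrs(3)[OF N] by simp
    with br(2) have "f 1 = N + 1" using N by (elim disjE insertE emptyE) linarith+
    with * show ?thesis using that by blast
  next
    assume *: "f 0 = N + 1"
    then have "f 1 = N \<or> f 1 = N + 2 \<or> f 1 = 2 * N + 1" using f01 box_nbrs(4)[OF N] by simp
    with br(2) have "f 1 = N" using N by (elim disjE insertE emptyE) linarith+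
    with * show ?thesis using that by blast
  qed
  then show thesis
  proof cases
    case 1
    then show ?thesis using box_endo_fixes[OF N f] by (intro that[of id]) auto
  next
    case *: 2
    have "box_endo N (box_refl N \<circ> f)"
      using box_endo_comp[OF N f box_refl[OF N] box_refl_refl[OF N]] by blast
    from box_endo_fixes[OF N this] * have "box_refl N (f x) = x" if "x < 2 * N + 2" for x
      using that by (simp add: box_refl_def)
    then have "f x = box_refl N x" if "x < 2 * N + 2" for x
      using that box_refl_refl[OF N] bound by metis
    then show ?thesis by (intro that[of "box_refl N"]) auto
  next
    case *: 3
    have "box_endo N (box_rot N \<circ> f)"
      using box_endo_comp[OF N f box_rot[OF N] box_rot_rot] by blast
    from box_endo_fixes[OF N this] * have "box_rot N (f x) = x" if "x < 2 * N + 2" for x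
      using that N by (simp add: box_rot_def)
    then have "f x = box_rot N x" if "x < 2 * N + 2" for x
      using that box_rot_rot bound by metis
    then show ?thesis by (intro that[of "box_rot N"]) auto
  next
    case *: 4
    have g: "box_endo N (box_rot N \<circ> f)"
      using box_endo_comp[OF N f box_rot[OF N] box_rot_rot] by blast
    have "box_endo N (box_refl N \<circ> (box_rot N \<circ> f))"
      using box_endo_comp[OF N g box_refl[OF N] box_refl_refl[OF N]] by blast
    from box_endo_fixes[OF N this] * have 1: "box_refl N (box_rot N (f x)) = x" if "x < 2 * N + 2" for x
      using that N by (simp add: box_rot_def box_refl_def)
    have rb: "box_rot N x < 2 * N + 2" if "x < 2 * N + 2" for x
      using that unfolding box_rot_def by auto
    have "f x = box_rot N (box_refl N x)" if "x < 2 * N + 2" for x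
      using 1[OF that] box_refl_refl[OF N rb[OF bound[OF that]]] box_rot_rot[OF bound[OF that]] by metis
    then show ?thesis by (intro that[of "box_rot N \<circ> box_refl N"]) auto
  qed
qed

section \<open>Necklaces\<close>

text \<open>Pairs of a copy and a vertex of the box graph are coded as numbers, because the family
  is to consist of graphs on \<open>nat\<close>.\<close>

definition vert :: "nat \<Rightarrow> nat \<Rightarrow> nat" where
  "vert i x = prod_encode (i, x)"

definition copy_idx :: "nat \<Rightarrow> nat" where
  "copy_idx v = fst (prod_decode v)"

definition local_vertex :: "nat \<Rightarrow> nat" where
  "local_vertex v = snd (prod_decode v)"

lemma vert_simps [simp]: "copy_idx (vert i x) = i" "local_vertex (vert i x) = x" "vert (copy_idx v) (local_vertex v) = v"
  by (simp_all add: vert_def copy_idx_def local_vertex_def)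

lemma vert_eq_iff: "u = v \<longleftrightarrow> copy_idx u = copy_idx v \<and> local_vertex u = local_vertex v"
  by (metis vert_simps(3))

definition verts_of :: "nat \<Rightarrow> nat \<Rightarrow> nat set" where
  "verts_of N n = {v. copy_idx v < n \<and> local_vertex v < 2 * N + 2}"

definition copies :: "nat \<Rightarrow> nat \<Rightarrow> nat rel" where
  "copies N n = {(u, v). copy_idx u = copy_idx v \<and> copy_idx u < n \<and> (local_vertex u, local_vertex v) \<in> box N}"

definition nxt :: "nat \<Rightarrow> nat \<Rightarrow> nat" where
  "nxt n i = (if Suc i = n then 0 else Suc i)"

text \<open>Both vertices are inside the path from 1 to \<open>N\<close>, in different orbits of the
  four-group, so that a homomorphism has to recognise the first copy.\<close>

definition port :: "nat \<Rightarrow> nat" where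
  "port i = (if i = 0 then 2 else 3)"

definition ring_arc :: "nat \<Rightarrow> nat \<Rightarrow> nat \<Rightarrow> nat \<Rightarrow> bool" where
  "ring_arc N n u v \<longleftrightarrow> copy_idx u < n \<and> local_vertex u = port (copy_idx u) \<and> copy_idx v = nxt n (copy_idx u) \<and> local_vertex v = 2 * N"

definition ring :: "nat \<Rightarrow> nat \<Rightarrow> nat rel" where
  "ring N n = {(u, v). ring_arc N n u v \<or> ring_arc N n v u}"

definition mid :: "nat \<Rightarrow> nat \<Rightarrow> bool" where
  "mid N v \<longleftrightarrow> local_vertex v \<ge> 2 * N"

text \<open>All that the homomorphism argument needs to know about a completed graph; degrees do not
  occur. With the bound \<open>N + 2\<close>, edges outside the copies lie on no cycle of length up
  to the odd girth.\<close>

definition necklace :: "nat \<Rightarrow> nat \<Rightarrow> nat rel \<Rightarrow> bool" where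
  "necklace N n R \<longleftrightarrow> sym R \<and> R \<subseteq> verts_of N n \<times> verts_of N n \<and> copies N n \<union> ring N n \<subseteq> R \<and>
    (\<forall>u v. (u, v) \<in> R - copies N n \<longrightarrow> far (N + 2) (R - {(u, v), (v, u)}) u v) \<and>
    (\<forall>u v. (u, v) \<in> R - (copies N n \<union> ring N n) \<longrightarrow> mid N u = mid N v)"

lemma necklaceD:
  assumes "necklace N n R"
  shows "sym R" "R \<subseteq> verts_of N n \<times> verts_of N n" "copies N n \<union> ring N n \<subseteq> R"
    and "\<And>u v. (u, v) \<in> R - copies N n \<Longrightarrow> far (N + 2) (R - {(u, v), (v, u)}) u v"
    and "\<And>u v. (u, v) \<in> R - (copies N n \<union> ring N n) \<Longrightarrow> mid N u = mid N v"
  using assms unfolding necklace_def by blast+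

lemma copies_relpow:
  "(u, v) \<in> copies N n ^^ k \<Longrightarrow> (local_vertex u, local_vertex v) \<in> box N ^^ k"
proof (induction k arbitrary: v)
  case (Suc k)
  then obtain w where "(u, w) \<in> copies N n ^^ k" "(w, v) \<in> copies N n" by auto
  moreover from this have "(local_vertex w, local_vertex v) \<in> box N" by (simp add: copies_def)
  ultimately show ?case using Suc.IH by (meson relpow_Suc_I)
qed auto

text \<open>An edge outside the copies of the box lies on no closed walk of the least odd length: either the
  rest of the walk avoids the edge, or cutting at a second passage leaves a shorter odd closed walk.\<close>

lemma necklace_odd_edge:
  assumes R: "necklace N n R" and k: "odd k" "k \<le> N + 2"
    and no_shorter: "\<And>j v. odd j \<Longrightarrow> j < k \<Longrightarrow> (v, v) \<notin> R ^^ j"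
    and uv: "(u, v) \<in> R" "(v, u) \<in> R ^^ (k - 1)"
  shows "(u, v) \<in> copies N n"
proof (rule ccontr)
  assume nc: "(u, v) \<notin> copies N n"
  let ?E = "{(u, v), (v, u)}"
  note D = necklaceD[OF R]
  have far: "far (N + 2) (R - ?E) u v" using D(4) uv(1) nc by blast
  have "sym (R - ?E)" using D(1) by (auto simp: sym_def)
  then have "far (N + 2) (R - ?E) v u" using far by (rule far_sym)
  moreover have "k - 1 < N + 2" using k by (cases k) auto
  ultimately have "(v, u) \<notin> (R - ?E) ^^ (k - 1)" unfolding far_def by blast
  with relpow_avoid[OF uv(2), of ?E] obtain s t a b where ab: "(a, b) \<in> ?E"
    and st: "(v, a) \<in> R ^^ s" "(b, u) \<in> R ^^ t" "s + t + 1 = k - 1"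
    by blast
  have lt: "s + 1 < k" "t + 1 < k" using st(3) by linarith+
  have par: "odd s \<longleftrightarrow> even t" using st(3) k(1) by presburger
  \<comment> \<open>The sum \<open>s + t\<close> is odd. If the second passage goes from
    \<open>v\<close> to \<open>u\<close>, the two pieces are closed; if it goes from
    \<open>u\<close> to \<open>v\<close>, the arc \<open>uv\<close> closes each of them. Either way
    one of the two closed walks is odd and shorter than \<open>k\<close>.\<close>
  from ab consider "a = v" "b = u" | "a = u" "b = v" by blast
  then show False
  proof cases
    case 1
    then show ?thesis using st no_shorter[of s v] no_shorter[of t u] lt par by (cases "odd s") auto
  next
    case 2
    then have "(v, v) \<in> R ^^ Suc s" "(v, v) \<in> R ^^ Suc t"
      using st uv(1) by (meson relpow_Suc_I)+
    then show ?thesis using no_shorter[of "Suc s" v] no_shorter[of "Suc t" v] lt par by (cases "odd s") auto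
  qed
qed

text \<open>A shortest odd closed walk below the bound either stays in the copies and projects to
  the box graph, or uses an arc outside them, which \<open>necklace_odd_edge\<close>
  excludes.\<close>

lemma necklace_no_short_odd:
  assumes N: "N \<ge> 5" "odd N" and R: "necklace N n R"
  shows "odd k \<Longrightarrow> (x, x) \<in> R ^^ k \<Longrightarrow> k \<ge> N + 2"
proof (induction k arbitrary: x rule: less_induct)
  case (less k)
  show ?case
  proof (rule ccontr)
    assume "\<not> k \<ge> N + 2"
    then have k: "k < N + 2" by simp
    have no_shorter: "(v, v) \<notin> R ^^ j" if "odd j" "j < k" for j v
      using less.IH[OF that(2,1)] k that by fastforce
    from relpow_avoid[OF less.prems(2), of "- copies N n"] show False
    proof (elim disjE exE conjE)
      assume "(x, x) \<in> (R - - copies N n) ^^ k"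
      then have "(x, x) \<in> copies N n ^^ k" by (rule relpow_le_mono[rotated]) auto
      then have "(local_vertex x, local_vertex x) \<in> box N ^^ k" by (rule copies_relpow)
      then show False using box_no_short_odd[OF N] less.prems(1) k by fastforce
    next
      fix s t a b
      assume ab: "(a, b) \<in> R \<inter> - copies N n" and st: "(x, a) \<in> R ^^ s" "(b, x) \<in> R ^^ t" "s + t + 1 = k"
      have "(b, a) \<in> R ^^ (t + s)" using st by (blast intro: relpow_add_I)
      moreover have "t + s = k - 1" using st by simp
      ultimately have "(b, a) \<in> R ^^ (k - 1)" by simp
      then have "(a, b) \<in> copies N n"
        using less.prems(1) k ab no_shorter by (intro necklace_odd_edge[OF R, of k]) auto
      then show False using ab by simp
    qed
  qed
qed

text \<open>Homomorphisms preserve closed walks of length \<open>N + 2\<close>, so this is how the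
  edges of copies are recognised in the target.\<close>

lemma necklace_girth_edge:
  assumes N: "N \<ge> 5" "odd N" and R: "necklace N n R" and uv: "(u, v) \<in> R" "(v, u) \<in> R ^^ (N + 1)"
  shows "(u, v) \<in> copies N n"
proof (rule necklace_odd_edge[OF R, of "N + 2"])
  show "(w, w) \<notin> R ^^ j" if "odd j" "j < N + 2" for j w
    using necklace_no_short_odd[OF N R that(1)] that(2) by (meson not_le)
qed (use N uv in auto)

section \<open>Homomorphisms between necklaces\<close>

lemma box_two_nbrs:
  assumes N: "N \<ge> 5" and "y < 2 * N + 2"
  obtains a b where "(y, a) \<in> box N" "(y, b) \<in> box N" "a \<noteq> b"
proof -
  from assms(2) show thesis
  proof (cases rule: box_vertex_cases)
    case 1
    then have "(y, 1) \<in> box N" "(y, 2 * N) \<in> box N" "1 \<noteq> 2 * N"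
      using box_nbrs(1)[OF N] N by simp_all
    then show thesis by (rule that)
  next
    case 2
    then have "(y, 0) \<in> box N" "(y, 2) \<in> box N" "0 \<noteq> (2 :: nat)"
      using box_nbrs(2)[OF N] N by simp_all
    then show thesis by (rule that)
  next
    case 3
    then have "(y, N + 1) \<in> box N" "(y, 2 * N) \<in> box N" "N + 1 \<noteq> 2 * N"
      using box_nbrs(3)[OF N] N by simp_all
    then show thesis by (rule that)
  next
    case 4
    then have "(y, N) \<in> box N" "(y, 2 * N + 1) \<in> box N" "N \<noteq> 2 * N + 1"
      using box_nbrs(4)[OF N] N by simp_all
    then show thesis by (rule that)
  next
    case 5
    then have "(y, 0) \<in> box N" "(y, N) \<in> box N" "0 \<noteq> N"
      using box_nbrs(5)[OF N] N by simp_all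
    then show thesis by (rule that)
  next
    case 6
    then have "(y, 1) \<in> box N" "(y, N + 1) \<in> box N" "1 \<noteq> N + 1"
      using box_nbrs(6)[OF N] N by simp_all
    then show thesis by (rule that)
  next
    case 7
    then have "(y, y - 1) \<in> box N" "(y, y + 1) \<in> box N" "y - 1 \<noteq> y + 1"
      using box_nbrs_arc[of y N] N by simp_all
    then show thesis by (rule that)
  next
    case 8
    then have "(y, y - 1) \<in> box N" "(y, y + 1) \<in> box N" "y - 1 \<noteq> y + 1"
      using box_nbrs_arc[of y N] N by simp_all
    then show thesis by (rule that)
  next
    case 9
    then have "(y, 0) \<in> box N" "(y, 2 * N - 2) \<in> box N" "0 \<noteq> 2 * N - 2"
      using box_nbrs_last[OF N] N by simp_all
    then show thesis by (rule that)
  qed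
qed

lemma box_edge_close:
  assumes N: "N \<ge> 5" and xy: "(x, y) \<in> box N"
  shows "(y, x) \<in> box N ^^ (N + 1)"
proof -
  have "y < 2 * N + 2" using box_bounds[OF _ xy] N by simp
  then obtain z where z: "(y, z) \<in> box N" "z \<noteq> x" using box_two_nbrs[OF N] by metis
  have "(x, z) \<in> box N ^^ N" using box_close_path[OF N xy z(1)] z(2) by auto
  then have "(z, x) \<in> box N ^^ N" by (rule sym_relpow[OF sym_box])
  then have "(y, x) \<in> box N ^^ Suc N" using z(1) by (rule relpow_Suc_I2[rotated])
  then show ?thesis by simp
qed

lemma box_connected:
  assumes N: "N \<ge> 5" and x: "x < 2 * N + 2"
  shows "\<exists>k. (0, x) \<in> box N ^^ k"
proof -
  have *: "\<exists>k. (0, y) \<in> box N ^^ k" if "y < 2 * N" for y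
    using box_arc[of 0 y N] that by auto
  from x consider "x < 2 * N" | "x = 2 * N" | "x = 2 * N + 1" by linarith
  then show ?thesis
  proof cases
    case 2
    have "(0, 2 * N) \<in> box N ^^ 1" using box_nbrs(1)[OF N] by simp
    then show ?thesis unfolding 2 by blast
  next
    case 3
    obtain k where "(0, 1) \<in> box N ^^ k" using *[of 1] N by auto
    moreover have "(1, 2 * N + 1) \<in> box N" using box_nbrs(2)[OF N] by simp
    ultimately have "(0, 2 * N + 1) \<in> box N ^^ Suc k" by (rule relpow_Suc_I)
    then show ?thesis unfolding 3 by blast
  qed (rule *)
qed

definition box_syms :: "nat \<Rightarrow> (nat \<Rightarrow> nat) set" where
  "box_syms N = {id, box_rot N, box_refl N, box_rot N \<circ> box_refl N}"

text \<open>The image of 2 identifies the group element. That of 3 does not if \<open>N = 5\<close>: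
  there 3 is the midpoint of its path and fixed by \<open>box_rot N \<circ> box_refl N\<close>. As
  this map swaps the middle vertices, the value at \<open>2 * N\<close> decides.\<close>

lemma box_syms_values:
  assumes "N \<ge> 5" "s \<in> box_syms N"
  shows "s 2 \<in> {2, N + 2, 2 * N - 1, N - 1}" "s 3 \<in> {3, N + 3, 2 * N - 2, N - 2}"
    "s (2 * N) \<in> {2 * N, 2 * N + 1}" "s 2 = 2 \<Longrightarrow> s = id"
    "s (2 * N) = 2 * N \<Longrightarrow> s 3 = 3 \<Longrightarrow> s = id"
proof -
  have vals: "box_rot N 2 = N + 2" "box_rot N 3 = N + 3" "box_rot N (2 * N) = 2 * N"
    "box_refl N 2 = 2 * N - 1" "box_refl N 3 = 2 * N - 2" "box_refl N (2 * N) = 2 * N + 1"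
    "box_rot N (2 * N - 1) = N - 1" "box_rot N (2 * N - 2) = N - 2" "box_rot N (2 * N + 1) = 2 * N + 1"
    using assms(1) by (simp_all add: box_rot_def box_refl_def)
  from assms(2) have "s = id \<or> s = box_rot N \<or> s = box_refl N \<or> s = box_rot N \<circ> box_refl N"
    unfolding box_syms_def by simp
  then have *: "s 2 \<in> {2, N + 2, 2 * N - 1, N - 1} \<and> s 3 \<in> {3, N + 3, 2 * N - 2, N - 2} \<and>
      s (2 * N) \<in> {2 * N, 2 * N + 1}"
    by (elim disjE) (simp_all add: vals vals[simplified])
  then show "s 2 \<in> {2, N + 2, 2 * N - 1, N - 1}" "s 3 \<in> {3, N + 3, 2 * N - 2, N - 2}"
    "s (2 * N) \<in> {2 * N, 2 * N + 1}"
    by simp_all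
  have id2: "s = id \<or> s 2 \<in> {N + 2, 2 * N - 1, N - 1}" and id3: "s = id \<or> s 3 = N + 3 \<or> s (2 * N) = 2 * N + 1"
    using assms(2) unfolding box_syms_def by (auto simp: vals vals[simplified])
  have "2 \<notin> {N + 2, 2 * N - 1, N - 1}" using assms(1) by (simp; linarith)
  then show "s 2 = 2 \<Longrightarrow> s = id" using id2 by metis
  show "s (2 * N) = 2 * N \<Longrightarrow> s 3 = 3 \<Longrightarrow> s = id" using id3 assms(1) by linarith
qed

text \<open>Each edge of the copy is on a face, so its image is on a closed walk of length
  \<open>N + 2\<close> and hence in a copy; by connectedness this is always the same one.\<close>

lemma necklace_hom_copy:
  assumes N: "N \<ge> 5" "odd N" and R: "necklace N n R" "necklace N n' R'"
    and h: "\<And>v. v \<in> verts_of N n \<Longrightarrow> h v \<in> verts_of N n'" "\<And>u v. (u, v) \<in> R \<Longrightarrow> (h u, h v) \<in> R'"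
    and i: "i < n"
  obtains j s where "j < n'" "s \<in> box_syms N" "\<And>x. x < 2 * N + 2 \<Longrightarrow> h (vert i x) = vert j (s x)"
proof -
  let ?e = "\<lambda>x. h (vert i x)"
  have hom: "(?e x, ?e y) \<in> R'" if "(x, y) \<in> box N" for x y
  proof -
    have "(vert i x, vert i y) \<in> copies N n" using that i by (simp add: copies_def)
    then show ?thesis using necklaceD(3)[OF R(1)] h(2) by blast
  qed
  have hom_pow: "(?e x, ?e y) \<in> R' ^^ k" if "(x, y) \<in> box N ^^ k" for x y k
    using that
  proof (induction k arbitrary: y)
    case (Suc k)
    then obtain w where "(x, w) \<in> box N ^^ k" "(w, y) \<in> box N" by auto
    then show ?case using Suc.IH hom by (meson relpow_Suc_I)
  qed auto
  have edge: "(?e x, ?e y) \<in> copies N n'" if "(x, y) \<in> box N" for x y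
    using necklace_girth_edge[OF N R(2) hom[OF that] hom_pow[OF box_edge_close[OF N(1) that]]] .
  have cp_edge: "copy_idx (?e x) = copy_idx (?e y)" if "(x, y) \<in> box N" for x y
    using edge[OF that] by (simp add: copies_def)
  have cp_pow: "copy_idx (?e x) = copy_idx (?e y)" if "(x, y) \<in> box N ^^ k" for x y k
    using that
  proof (induction k arbitrary: y)
    case (Suc k)
    then obtain w where "(x, w) \<in> box N ^^ k" "(w, y) \<in> box N" by auto
    then show ?case using Suc.IH cp_edge by metis
  qed auto
  let ?j = "copy_idx (?e 0)"
  have copy_idx: "copy_idx (?e x) = ?j" if "x < 2 * N + 2" for x
    using box_connected[OF N(1) that] cp_pow by metis
  have "box_endo N (\<lambda>x. local_vertex (?e x))" unfolding box_endo_def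
  proof (intro conjI allI impI)
    show "(local_vertex (?e x), local_vertex (?e y)) \<in> box N" if "(x, y) \<in> box N" for x y
      using edge[OF that] by (simp add: copies_def)
    fix x y z assume xyz: "(x, y) \<in> box N" "(y, z) \<in> box N" "x \<noteq> z"
    \<comment> \<open>Equal images would make this walk of odd length \<open>N\<close> closed, below
      the least possible length \<open>N + 2\<close>.\<close>
    have "(?e x, ?e z) \<in> R' ^^ N" using hom_pow[OF box_close_path[OF N(1) xyz]] .
    then have "?e x \<noteq> ?e z" using necklace_no_short_odd[OF N R(2) N(2), of "?e x"] by auto
    moreover have "copy_idx (?e x) = copy_idx (?e z)" using cp_edge[OF xyz(1)] cp_edge[OF xyz(2)] by simp
    ultimately show "local_vertex (?e x) \<noteq> local_vertex (?e z)" using vert_eq_iff[of "?e x" "?e z"] by simp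
  qed
  from box_endo_cases[OF N(1) this] obtain s where "s \<in> box_syms N"
    "\<And>x. x < 2 * N + 2 \<Longrightarrow> local_vertex (?e x) = s x" unfolding box_syms_def by metis
  moreover have "?j < n'" using h(1)[of "vert i 0"] i by (simp add: verts_of_def)
  moreover from calculation have "?e x = vert ?j (s x)" if "x < 2 * N + 2" for x
    using copy_idx[OF that] that by (metis vert_simps(3))
  ultimately show ?thesis using that by blast
qed

theorem necklace_hom:
  assumes N: "N \<ge> 5" "odd N" and R: "necklace N n R" "necklace N n' R'" and n: "n > 0"
    and h: "\<And>v. v \<in> verts_of N n \<Longrightarrow> h v \<in> verts_of N n'" "\<And>u v. (u, v) \<in> R \<Longrightarrow> (h u, h v) \<in> R'"
  shows "n = n' \<and> (\<forall>v \<in> verts_of N n. h v = v)"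
proof -
  have "\<forall>i<n. \<exists>j s. j < n' \<and> s \<in> box_syms N \<and> (\<forall>x < 2 * N + 2. h (vert i x) = vert j (s x))"
  proof (intro allI impI)
    fix i assume "i < n"
    from necklace_hom_copy[where h = h, OF N R h this] show "\<exists>j s. j < n' \<and> s \<in> box_syms N \<and>
      (\<forall>x < 2 * N + 2. h (vert i x) = vert j (s x))" by blast
  qed
  then obtain J S where JS: "\<And>i. i < n \<Longrightarrow> J i < n'" "\<And>i. i < n \<Longrightarrow> S i \<in> box_syms N"
    "\<And>i x. i < n \<Longrightarrow> x < 2 * N + 2 \<Longrightarrow> h (vert i x) = vert (J i) (S i x)"
    by metis
  have nxt_lt: "nxt n i < n" if "i < n" for i using that by (auto simp: nxt_def)
  have step: "S i (port i) = port (J i) \<and> J (nxt n i) = nxt n' (J i) \<and> S (nxt n i) (2 * N) = 2 * N"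
    if i: "i < n" for i
  proof -
    let ?p = "S i (port i)" and ?m = "S (nxt n i) (2 * N)"
    have "(vert i (port i), vert (nxt n i) (2 * N)) \<in> R"
      using i necklaceD(3)[OF R(1)] by (auto simp: ring_def ring_arc_def)
    from h(2)[OF this] have e: "(vert (J i) ?p, vert (J (nxt n i)) ?m) \<in> R'"
      using JS(3) i nxt_lt[OF i] N(1) by (simp add: port_def)
    have p: "?p < 2 * N" "?p \<notin> {0, 1, N, N + 1}"
      using box_syms_values(1,2)[OF N(1) JS(2)[OF i]] N(1) by (auto simp: port_def)
    have m: "?m = 2 * N \<or> ?m = 2 * N + 1"
      using box_syms_values(3)[OF N(1) JS(2)[OF nxt_lt[OF i]]] by blast
    \<comment> \<open>The group elements preserve the set of middle vertices, so the image of a ring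
      edge still has exactly one end there and is not an added edge.\<close>
    have "mid N (vert (J i) ?p) \<noteq> mid N (vert (J (nxt n i)) ?m)"
      using p m by (auto simp: mid_def)
    then have "(vert (J i) ?p, vert (J (nxt n i)) ?m) \<in> copies N n' \<union> ring N n'"
      using necklaceD(5)[OF R(2)] e by blast
    \<comment> \<open>Inside a copy a middle vertex has only branch vertices as neighbours, and no
      group element takes a port to a branch vertex.\<close>
    moreover have "(vert (J i) ?p, vert (J (nxt n i)) ?m) \<notin> copies N n'"
    proof
      assume "(vert (J i) ?p, vert (J (nxt n i)) ?m) \<in> copies N n'"
      then have "(?m, ?p) \<in> box N" using sym_box by (auto simp: copies_def dest: symD)
      then show False using m p box_nbrs(5,6)[OF N(1)] by auto
    qed
    ultimately have "ring_arc N n' (vert (J i) ?p) (vert (J (nxt n i)) ?m) \<or>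
        ring_arc N n' (vert (J (nxt n i)) ?m) (vert (J i) ?p)"
      by (auto simp: ring_def)
    \<comment> \<open>The end with local vertex below \<open>2 * N\<close> must be the source, so
      the ring keeps its orientation.\<close>
    then show ?thesis using p(1) unfolding ring_arc_def by auto
  qed
  have port_eq: "port i = 2 \<longleftrightarrow> i = 0" "port i = 3 \<longleftrightarrow> i \<noteq> 0" for i by (auto simp: port_def)
  have S0: "S 0 2 = 2 \<and> J 0 = 0"
  proof -
    have "S 0 2 = port (J 0)" using step[OF n] by (simp add: port_def)
    moreover have "S 0 2 \<noteq> 3" using box_syms_values(1)[OF N(1) JS(2)[OF n]] N(1) by auto
    ultimately show ?thesis using port_eq[of "J 0"] by metis
  qed
  have S1: "S i 3 = 3 \<and> J i \<noteq> 0" if "i < n" "i \<noteq> 0" for i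
  proof -
    have "S i 3 = port (J i)" using step[OF that(1)] that by (simp add: port_def)
    moreover have "S i 3 \<noteq> 2" using box_syms_values(2)[OF N(1) JS(2)[OF that(1)]] N(1) by auto
    ultimately show ?thesis using port_eq[of "J i"] by metis
  qed
  have Sid: "S i = id" if "i < n" for i
  proof (cases "i = 0")
    case True
    then show ?thesis using box_syms_values(4)[OF N(1) JS(2)[OF n]] S0 by simp
  next
    case False
    then have "nxt n (i - 1) = i" using that by (auto simp: nxt_def)
    then have "S i (2 * N) = 2 * N" using step[of "i - 1"] that by simp
    then show ?thesis using box_syms_values(5)[OF N(1) JS(2)[OF that]] S1[OF that False] by simp
  qed
  have Jid: "J i = i" if "i < n" for i
    using that
  proof (induction i)
    case (Suc i)
    then have "nxt n i = Suc i" by (auto simp: nxt_def)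
    then have "J (Suc i) = nxt n' i" using step[of i] Suc by simp
    \<comment> \<open>Only copy 0 goes to copy 0, so the target ring cannot close before the source
      ring does.\<close>
    then show ?case using S1[of "Suc i"] Suc.prems by (auto simp: nxt_def split: if_splits)
  qed (use S0 in simp)
  have "nxt n (n - 1) = 0" using n by (simp add: nxt_def)
  \<comment> \<open>The last ring arc of the source returns to copy 0, hence so does its image,
    which leaves copy \<open>n - 1\<close>.\<close>
  then have "nxt n' (n - 1) = 0" using step[of "n - 1"] Jid[of "n - 1"] Jid[of 0] n by simp
  then have "n = n'" using n by (auto simp: nxt_def split: if_splits)
  moreover have "h v = v" if "v \<in> verts_of N n" for v
    using that JS(3)[of "copy_idx v" "local_vertex v"] Sid[of "copy_idx v"] Jid[of "copy_idx v"] by (simp add: verts_of_def)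
  ultimately show ?thesis by blast
qed

section \<open>Existence of regular necklaces\<close>

lemma sym_copies: "sym (copies N n)"
  using sym_box unfolding copies_def sym_def by auto

lemma sym_ring: "sym (ring N n)"
  unfolding ring_def sym_def by auto

lemma nxt_less: "i < n \<Longrightarrow> nxt n i < n"
  by (auto simp: nxt_def)

lemma copies_subset: "N \<ge> 5 \<Longrightarrow> copies N n \<subseteq> verts_of N n \<times> verts_of N n"
  using box_bounds[of N] by (auto simp: copies_def verts_of_def)

lemma ring_arc_verts: "N \<ge> 5 \<Longrightarrow> ring_arc N n u v \<Longrightarrow> u \<in> verts_of N n \<and> v \<in> verts_of N n"
  by (simp add: ring_arc_def verts_of_def port_def nxt_less)

lemma ring_subset: "N \<ge> 5 \<Longrightarrow> ring N n \<subseteq> verts_of N n \<times> verts_of N n"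
  using ring_arc_verts by (auto simp: ring_def)

lemma ring_arc_cp: "n > 1 \<Longrightarrow> ring_arc N n u v \<Longrightarrow> copy_idx u \<noteq> copy_idx v"
  by (simp add: ring_arc_def nxt_def)

lemma ring_cp: "n > 1 \<Longrightarrow> (u, v) \<in> ring N n \<Longrightarrow> copy_idx u \<noteq> copy_idx v"
  unfolding ring_def using ring_arc_cp by fastforce

text \<open>Cut the ring at the removed edge and number the copies along it by \<open>pos\<close>,
  from 0 at \<open>v\<close> to \<open>n - 1\<close> at \<open>u\<close>. Every remaining edge
  changes the number by at most 1, so walks from \<open>u\<close> to \<open>v\<close> have length at
  least \<open>n - 1\<close>.\<close>

lemma ring_arc_far:
  assumes n: "n > g" and uv: "ring_arc N n u v"
  shows "far g (copies N n \<union> ring N n - {(u, v), (v, u)}) u v"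
proof -
  let ?S = "copies N n \<union> ring N n - {(u, v), (v, u)}"
  define i where "i = copy_idx u"
  define pos where "pos w = (if copy_idx w > i then copy_idx w - (i + 1) else copy_idx w + n - (i + 1))" for w
  have arc: "pos b = pos a + 1" if "ring_arc N n a b" "(a, b) \<noteq> (u, v)" for a b
  proof -
    have "copy_idx a \<noteq> i"
    proof
      assume "copy_idx a = i"
      then have "a = u" "b = v"
        using that(1) uv vert_eq_iff[of a u] vert_eq_iff[of b v]
        unfolding ring_arc_def i_def by auto
      then show False using that(2) by simp
    qed
    moreover have "copy_idx a < n" "copy_idx b = nxt n (copy_idx a)" "i < n"
      using that(1) uv by (simp_all add: ring_arc_def i_def)
    ultimately show ?thesis unfolding pos_def nxt_def by (cases "Suc (copy_idx a) = n") auto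
  qed
  have step: "pos a \<le> pos b + 1" if "(a, b) \<in> ?S" for a b
  proof -
    from that consider "(a, b) \<in> copies N n" | "ring_arc N n a b" | "ring_arc N n b a"
      by (auto simp: ring_def)
    then show ?thesis
    proof cases
      case 1 then show ?thesis by (simp add: copies_def pos_def)
    next
      case 2 then show ?thesis using arc[of a b] that by auto
    next
      case 3 then show ?thesis using arc[of b a] that by auto
    qed
  qed
  have walk: "pos a \<le> pos b + k" if "(a, b) \<in> ?S ^^ k" for a b k
    using that
  proof (induction k arbitrary: b)
    case (Suc k)
    then obtain c where c: "(a, c) \<in> ?S ^^ k" "(c, b) \<in> ?S" by auto
    show ?case using Suc.IH[OF c(1)] step[OF c(2)] by simp
  qed auto
  have "pos u = n - 1" "pos v = 0"
    using uv unfolding pos_def i_def ring_arc_def nxt_def by auto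
  then show ?thesis using n walk[of u v] unfolding far_def by fastforce
qed

lemma ring_far:
  assumes n: "n > g" and uv: "(u, v) \<in> ring N n"
  shows "far g (copies N n \<union> ring N n - {(u, v), (v, u)}) u v"
proof -
  let ?S = "copies N n \<union> ring N n - {(u, v), (v, u)}"
  have "sym ?S" using sym_copies sym_ring unfolding sym_def by blast
  from uv consider "ring_arc N n u v" | "ring_arc N n v u" by (auto simp: ring_def)
  then show ?thesis
  proof cases
    case 2
    have "?S = copies N n \<union> ring N n - {(v, u), (u, v)}" by blast
    then show ?thesis using far_sym[OF \<open>sym ?S\<close>, of g v u] ring_arc_far[OF n 2] by simp
  qed (rule ring_arc_far[OF n])
qed

section \<open>Degrees and missing degrees before the completion\<close>

definition box_degree :: "nat \<Rightarrow> nat \<Rightarrow> nat" where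
  "box_degree N x = (if x \<in> {0, 1, N, N + 1} then 3 else 2)"

lemma card_box_nbrs:
  assumes N: "N \<ge> 5" and x: "x < 2 * N + 2"
  shows "card (box N `` {x}) = box_degree N x"
  using x
proof (cases rule: box_vertex_cases)
  case 1
  then have "box N `` {x} = {1, 2 * N - 1, 2 * N}" using box_nbrs(1)[OF N] by auto
  then show ?thesis using 1 N by (auto simp: box_degree_def card_insert_if)
next
  case 2
  then have "box N `` {x} = {0, 2, 2 * N + 1}" using box_nbrs(2)[OF N] by auto
  then show ?thesis using 2 N by (auto simp: box_degree_def card_insert_if)
next
  case 3
  then have "box N `` {x} = {N - 1, N + 1, 2 * N}" using box_nbrs(3)[OF N] by auto
  then show ?thesis using 3 N by (auto simp: box_degree_def card_insert_if)
next
  case 4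
  then have "box N `` {x} = {N, N + 2, 2 * N + 1}" using box_nbrs(4)[OF N] by auto
  then show ?thesis using 4 N by (auto simp: box_degree_def card_insert_if)
next
  case 5
  then have "box N `` {x} = {0, N}" using box_nbrs(5)[OF N] by auto
  then show ?thesis using 5 N by (auto simp: box_degree_def card_insert_if)
next
  case 6
  then have "box N `` {x} = {1, N + 1}" using box_nbrs(6)[OF N] by auto
  then show ?thesis using 6 N by (auto simp: box_degree_def card_insert_if)
next
  case 7
  then have "box N `` {x} = {x - 1, x + 1}" using box_nbrs_arc[of x N] by auto
  then show ?thesis using 7 N by (auto simp: box_degree_def card_insert_if)
next
  case 8
  then have "box N `` {x} = {x - 1, x + 1}" using box_nbrs_arc[of x N] by auto
  then show ?thesis using 8 N by (auto simp: box_degree_def card_insert_if)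
next
  case 9
  then have "box N `` {x} = {0, 2 * N - 2}" using box_nbrs_last[OF N] by auto
  then show ?thesis using 9 N by (auto simp: box_degree_def card_insert_if)
qed

definition base_degree :: "nat \<Rightarrow> nat \<Rightarrow> nat \<Rightarrow> nat" where
  "base_degree N i x = box_degree N x + (if x = port i then 1 else 0) + (if x = 2 * N then 1 else 0)"

lemma card_base_nbrs:
  assumes N: "N \<ge> 5" and n: "n > 1" and v: "v \<in> verts_of N n"
  shows "card ((copies N n \<union> ring N n) `` {v}) = base_degree N (copy_idx v) (local_vertex v)"
proof -
  have lt: "copy_idx v < n" "local_vertex v < 2 * N + 2" using v by (auto simp: verts_of_def)
  have cop: "copies N n `` {v} = vert (copy_idx v) ` (box N `` {local_vertex v})"
  proof (intro set_eqI iffI)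
    fix w assume "w \<in> copies N n `` {v}"
    then have "copy_idx w = copy_idx v" "(local_vertex v, local_vertex w) \<in> box N" by (auto simp: copies_def)
    then show "w \<in> vert (copy_idx v) ` (box N `` {local_vertex v})" by (metis Image_singleton_iff imageI vert_simps(3))
  qed (use lt in \<open>auto simp: copies_def\<close>)
  have "inj (vert (copy_idx v))" by (metis injI vert_simps(2))
  then have c1: "card (copies N n `` {v}) = box_degree N (local_vertex v)"
    unfolding cop using card_box_nbrs[OF N lt(2)] by (simp add: card_image inj_on_subset)
  define p where "p = (if copy_idx v = 0 then n - 1 else copy_idx v - 1)"
  have p: "p < n" "nxt n p = copy_idx v" using lt n by (auto simp: p_def nxt_def)
  have p_unique: "j = p" if "j < n" "nxt n j = copy_idx v" for j
    using that lt n by (auto simp: p_def nxt_def split: if_splits)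
  have out: "ring_arc N n v w \<longleftrightarrow> local_vertex v = port (copy_idx v) \<and> w = vert (nxt n (copy_idx v)) (2 * N)" for w
    using lt vert_eq_iff[of w] by (auto simp: ring_arc_def)
  have inn: "ring_arc N n w v \<longleftrightarrow> local_vertex v = 2 * N \<and> w = vert p (port p)" for w
    using lt p p_unique[of "copy_idx w"] vert_eq_iff[of w "vert p (port p)"] by (auto simp: ring_arc_def)
  have ne: "port i \<noteq> 2 * N" for i using N by (simp add: port_def)
  have "ring N n `` {v} = (if local_vertex v = port (copy_idx v) then {vert (nxt n (copy_idx v)) (2 * N)} else {}) \<union>
      (if local_vertex v = 2 * N then {vert p (port p)} else {})"
    by (auto simp: ring_def out inn)
  then have c2: "card (ring N n `` {v}) = (if local_vertex v = port (copy_idx v) then 1 else 0) + (if local_vertex v = 2 * N then 1 else 0)"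
    using ne[of "copy_idx v"] by auto
  have "finite (copies N n `` {v})"
    using c1 by (intro card_ge_0_finite) (simp add: box_degree_def)
  moreover have "finite (ring N n `` {v})"
    by (rule finite_subset[of _ "{vert (nxt n (copy_idx v)) (2 * N), vert p (port p)}"]) (auto simp: ring_def out inn)
  moreover have "copies N n `` {v} \<inter> ring N n `` {v} = {}"
    using ring_cp[OF n] by (auto simp: copies_def)
  ultimately have "card (copies N n `` {v} \<union> ring N n `` {v}) = card (copies N n `` {v}) + card (ring N n `` {v})"
    by (rule card_Un_disjoint)
  moreover have "(copies N n \<union> ring N n) `` {v} = copies N n `` {v} \<union> ring N n `` {v}" by auto
  ultimately show ?thesis unfolding base_degree_def c1 c2 by simp
qed

lemma base_degree_le: "N \<ge> 5 \<Longrightarrow> base_degree N i x \<le> 3"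
  by (auto simp: base_degree_def box_degree_def port_def)

lemma verts_of_image: "verts_of N n = (\<lambda>(i, x). vert i x) ` ({..<n} \<times> {..<2 * N + 2})"
proof (intro set_eqI iffI)
  fix v assume "v \<in> verts_of N n"
  then have "(copy_idx v, local_vertex v) \<in> {..<n} \<times> {..<2 * N + 2}" "v = (\<lambda>(i, x). vert i x) (copy_idx v, local_vertex v)"
    by (auto simp: verts_of_def)
  then show "v \<in> (\<lambda>(i, x). vert i x) ` ({..<n} \<times> {..<2 * N + 2})" by blast
qed (auto simp: verts_of_def)

lemma finite_verts_of: "finite (verts_of N n)"
  unfolding verts_of_image by simp

lemma sum_verts_of:
  "(\<Sum>v | v \<in> verts_of N n \<and> mid N v = c. f (copy_idx v) (local_vertex v)) =
     (\<Sum>i<n. \<Sum>x | x < 2 * N + 2 \<and> (x \<ge> 2 * N) = c. f i x)"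
proof -
  let ?X = "{x. x < 2 * N + 2 \<and> (x \<ge> 2 * N) = c}"
  have "(\<Sum>i<n. sum (f i) ?X) = (\<Sum>(i, x)\<in>{..<n} \<times> ?X. f i x)"
    by (simp add: sum.cartesian_product)
  also have "\<dots> = (\<Sum>v | v \<in> verts_of N n \<and> mid N v = c. f (copy_idx v) (local_vertex v))"
    by (rule sum.reindex_bij_witness[of _ "\<lambda>v. (copy_idx v, local_vertex v)" "\<lambda>(i, x). vert i x"])
      (auto simp: verts_of_def mid_def)
  finally show ?thesis by simp
qed

text \<open>In class \<open>c\<close> every copy lacks the same amount: that of the box graph, less
  one for the single end of a ring edge in this class, whichever vertex is the port. With
  \<open>n\<close> even these equal summands add up to an even number.\<close>

lemma even_base_deficiency:
  assumes N: "N \<ge> 5" and n: "n > 1" "even n" and d: "d \<ge> 3"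
  shows "even (\<Sum>v | v \<in> verts_of N n \<and> mid N v = c. d - card ((copies N n \<union> ring N n) `` {v}))"
proof -
  let ?X = "{x. x < 2 * N + 2 \<and> (x \<ge> 2 * N) = c}"
  have "(\<Sum>v | v \<in> verts_of N n \<and> mid N v = c. d - card ((copies N n \<union> ring N n) `` {v})) =
      (\<Sum>v | v \<in> verts_of N n \<and> mid N v = c. d - base_degree N (copy_idx v) (local_vertex v))"
    by (intro sum.cong refl) (simp add: card_base_nbrs[OF N n(1)])
  also have "\<dots> = (\<Sum>i<n. \<Sum>x\<in>?X. d - base_degree N i x)"
    by (rule sum_verts_of)
  also have "\<dots> = (\<Sum>i<n. (\<Sum>x\<in>?X. d - box_degree N x) - 1)"
  proof (rule sum.cong[OF refl])
    fix i
    define q where "q = (if c then 2 * N else port i)"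
    have q: "q \<in> ?X" "box_degree N q = 2" using N by (auto simp: q_def port_def box_degree_def)
    have fin: "finite ?X" by simp
    have "d - base_degree N i x = d - box_degree N x" if "x \<in> ?X - {q}" for x
      using that N by (auto simp: base_degree_def q_def port_def split: if_splits)
    then have rest: "(\<Sum>x\<in>?X - {q}. d - base_degree N i x) = (\<Sum>x\<in>?X - {q}. d - box_degree N x)"
      by (rule sum.cong[OF refl])
    have "base_degree N i q = 3" using q(2) N by (auto simp: base_degree_def q_def port_def)
    then show "(\<Sum>x\<in>?X. d - base_degree N i x) = (\<Sum>x\<in>?X. d - box_degree N x) - 1"
      using rest q d sum.remove[OF fin q(1), of "\<lambda>x. d - base_degree N i x"]
        sum.remove[OF fin q(1), of "\<lambda>x. d - box_degree N x"] by simp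
  qed
  also have "even \<dots>" using n(2) by simp
  finally show ?thesis .
qed

lemma many_deficient:
  assumes N: "N \<ge> 5" and n: "n > 1" and d: "d \<ge> 3"
  shows "card {v \<in> verts_of N n. mid N v = c \<and> card ((copies N n \<union> ring N n) `` {v}) < d} \<ge> n"
proof -
  \<comment> \<open>Degree 2 in every copy: \<open>2 * N + 1\<close> is the middle vertex without a
    ring edge, and 4 is neither a port nor, as \<open>N \<ge> 5\<close>, a branch vertex.\<close>
  define q where "q = (if c then 2 * N + 1 else 4)"
  have q: "q < 2 * N + 2" "(q \<ge> 2 * N) = c" "base_degree N i q = 2" for i
    using N by (auto simp: q_def base_degree_def box_degree_def port_def)
  have inj: "inj_on (\<lambda>i. vert i q) {..<n}" by (metis inj_onI vert_simps(1))
  have "(\<lambda>i. vert i q) ` {..<n} \<subseteq> {v \<in> verts_of N n. mid N v = c \<and> card ((copies N n \<union> ring N n) `` {v}) < d}"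
  proof safe
    fix i assume "i < n"
    then show v: "vert i q \<in> verts_of N n" using q by (simp add: verts_of_def)
    show "card ((copies N n \<union> ring N n) `` {vert i q}) < d"
      using card_base_nbrs[OF N n v] q(3) d by simp
  qed (use q(2) in \<open>auto simp: mid_def\<close>)
  then have "card ((\<lambda>i. vert i q) ` {..<n}) \<le>
      card {v \<in> verts_of N n. mid N v = c \<and> card ((copies N n \<union> ring N n) `` {v}) < d}"
    by (intro card_mono) (auto simp: finite_verts_of)
  then show ?thesis by (simp add: card_image inj)
qed

text \<open>\<open>n\<close> is even for the parity in both colour classes; the summand
  \<open>N + 2\<close> keeps ring edges off short cycles, and the doubled sum lets a deficient
  vertex of either colour escape two balls of radius \<open>N + 2\<close>.\<close>

theorem exists_regular_necklace:
  assumes N: "N \<ge> 5" and d: "d \<ge> 3" and n: "even n" "n > N + 2 + 2 * (\<Sum>k\<le>N + 2. d ^ k)"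
  shows "\<exists>R. necklace N n R \<and> (\<forall>v\<in>verts_of N n. card (R `` {v}) = d)"
proof -
  interpret regular_completion "verts_of N n" "copies N n" "ring N n" "mid N" d "N + 2"
    by unfold_locales (rule finite_verts_of)
  have n': "n > N + 2" "n > 1" "n > 2 * (\<Sum>k\<le>N + 2. d ^ k)" using n by linarith+
  have "good (copies N n \<union> ring N n)"
  proof (rule goodI)
    show "sym (copies N n \<union> ring N n)"
      using sym_copies sym_ring unfolding sym_def by blast
    show "copies N n \<union> ring N n \<subseteq> verts_of N n \<times> verts_of N n"
      using copies_subset[OF N] ring_subset[OF N] by blast
    show "card ((copies N n \<union> ring N n) `` {v}) \<le> d" if "v \<in> verts_of N n" for v
      using card_base_nbrs[OF N n'(2) that] base_degree_le[OF N] d by (metis le_trans)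
    show "far (N + 2) (copies N n \<union> ring N n - {(u, v), (v, u)}) u v"
      if "(u, v) \<in> copies N n \<union> ring N n - copies N n" for u v
      using that by (intro ring_far[OF n'(1)]) blast
  qed auto
  moreover have "card {v \<in> verts_of N n. mid N v = mid N u \<and> card ((copies N n \<union> ring N n) `` {v}) < d}
      > 2 * (\<Sum>k\<le>N + 2. d ^ k)" for u
    using many_deficient[OF N n'(2) d, of "mid N u"] n'(3) by linarith
  ultimately obtain R where R: "good R" "\<forall>v\<in>verts_of N n. card (R `` {v}) = d"
    using exists_regular[OF _ sym_copies sym_ring _ even_base_deficiency[OF N n'(2) n(1) d]] by auto
  have "necklace N n R" using R(1) unfolding good_def necklace_def by simp
  then show ?thesis using R(2) by blast
qed

section \<open>Digraph invariants of necklaces\<close>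

lemma pcas_map_upt: "pcas (f a) (map (\<lambda>i. (f i, f (Suc i))) [a..<a + k]) (f (a + k))"
proof (induction k arbitrary: a)
  case (Suc k)
  have "[a..<a + Suc k] = a # [Suc a..<Suc a + k]" by (simp add: upt_rec[of a])
  then show ?case using Suc.IH[of "Suc a"] by simp
qed simp

lemma pawalk_verts_map_upt:
  "pawalk_verts (f a) (map (\<lambda>i. (f i, f (Suc i))) [a..<a + k]) = map f [a..<Suc (a + k)]"
proof (induction k arbitrary: a)
  case (Suc k)
  have "[a..<a + Suc k] = a # [Suc a..<Suc a + k]" "[a..<Suc (a + Suc k)] = a # [Suc a..<Suc (Suc a + k)]"
    by (simp_all add: upt_rec[of a])
  then show ?case using Suc.IH[of "Suc a"] by simp
qed simp

lemma pcas_relpow: "pcas u p v \<Longrightarrow> set p \<subseteq> R \<Longrightarrow> (u, v) \<in> R ^^ length p"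
proof (induction p arbitrary: u)
  case (Cons e p)
  then have "(snd e, v) \<in> R ^^ length p" "(u, snd e) \<in> R" by auto
  then have "(u, v) \<in> R ^^ Suc (length p)" by (meson relpow_Suc_I2)
  then show ?case by simp
qed simp

lemma necklace_girth_cycle:
  assumes N: "N \<ge> 5" and n: "n > 0" and R: "necklace N n R"
  shows "\<exists>p. pre_digraph.cycle (with_proj \<lparr>pverts = verts_of N n, parcs = R\<rparr>) p \<and> length p = N + 2"
proof -
  let ?G = "\<lparr>pverts = verts_of N n, parcs = R\<rparr>"
  \<comment> \<open>The face \<open>0, 1, ..., N, 2 * N\<close> of copy 0; the default value 0 at
    \<open>N + 2\<close> closes it.\<close>
  define x where "x i = (if i \<le> N then i else if i = N + 1 then 2 * N else 0)" for i
  define f where "f i = vert 0 (x i)" for i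
  let ?p = "map (\<lambda>i. (f i, f (Suc i))) [0..<0 + (N + 2)]"
  have edge: "(x i, x (Suc i)) \<in> box N" if "i < N + 2" for i
  proof -
    from that consider "i < N" | "i = N" | "i = N + 1" by linarith
    then show ?thesis
    proof cases
      case 1
      then have "box_adj N (x i) (x (Suc i))" by (simp add: x_def box_adj_def)
      then show ?thesis by (simp add: box_def)
    next
      case 2 then show ?thesis using box_nbrs(3)[OF N] by (simp add: x_def)
    next
      case 3 then show ?thesis using box_nbrs(5)[OF N] by (simp add: x_def)
    qed
  qed
  have "set ?p \<subseteq> copies N n" using edge n by (auto simp: copies_def f_def)
  then have arcs: "set ?p \<subseteq> R" using necklaceD(3)[OF R] by blast
  have "f (0 + (N + 2)) = f 0" by (simp add: f_def x_def)
  then have cas: "pcas (f 0) ?p (f 0)" using pcas_map_upt[of f 0 "N + 2"] by metis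
  have "f 0 \<in> verts_of N n" using n by (simp add: f_def x_def verts_of_def)
  moreover have "distinct (tl (pawalk_verts (f 0) ?p))"
  proof -
    have "inj_on x {1..<N + 3}" using N by (auto simp: inj_on_def x_def split: if_splits)
    then have "inj_on f {1..<N + 3}" unfolding f_def inj_on_def by (metis vert_simps(2))
    moreover have "tl (map f [0..<Suc (0 + (N + 2))]) = map f [1..<N + 3]"
      by (simp add: upt_rec[of 0] map_tl[symmetric] eval_nat_numeral del: upt_Suc)
    ultimately show ?thesis unfolding pawalk_verts_map_upt by (simp add: distinct_map del: upt_Suc)
  qed
  ultimately have "pre_digraph.cycle (with_proj ?G) ?p"
    using cas arcs unfolding pre_digraph.cycle_def pre_digraph.awalk_def
    by (auto simp: cas_with_proj_eq awalk_verts_with_proj_eq simp del: upt_Suc)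
  moreover have "length ?p = N + 2" by simp
  ultimately show ?thesis by blast
qed

lemma necklace_odd_girth:
  assumes N: "N \<ge> 5" "odd N" and n: "n > 0" and R: "necklace N n R"
  shows "odd_girth \<lparr>pverts = verts_of N n, parcs = R\<rparr> = enat (N + 2)"
  unfolding odd_girth_def
proof (rule antisym)
  let ?G = "\<lparr>pverts = verts_of N n, parcs = R\<rparr>"
  obtain p where p: "pre_digraph.cycle (with_proj ?G) p" "length p = N + 2"
    using necklace_girth_cycle[OF N(1) n R] by blast
  have "odd (length p)" using p(2) N(2) by simp
  then show "(INF p \<in> {p. pre_digraph.cycle (with_proj ?G) p \<and> odd (length p)}. enat (length p)) \<le> enat (N + 2)"
    using p by (intro INF_lower2[of p]) auto
  show "enat (N + 2) \<le> (INF p \<in> {p. pre_digraph.cycle (with_proj ?G) p \<and> odd (length p)}. enat (length p))"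
  proof (rule INF_greatest)
    fix q assume "q \<in> {p. pre_digraph.cycle (with_proj ?G) p \<and> odd (length p)}"
    then obtain u where "pcas u q u" "set q \<subseteq> R" and odd: "odd (length q)"
      unfolding pre_digraph.cycle_def pre_digraph.awalk_def by (auto simp: cas_with_proj_eq)
    then have "(u, u) \<in> R ^^ length q" by (intro pcas_relpow)
    then show "enat (N + 2) \<le> enat (length q)" using necklace_no_short_odd[OF N R odd] by simp
  qed
qed

lemma necklace_pair_graph:
  assumes "N > 0" and R: "necklace N n R"
  shows "pair_graph \<lparr>pverts = verts_of N n, parcs = R\<rparr>"
proof -
  note D = necklaceD[OF R]
  have "finite R" using D(2) finite_verts_of by (meson finite_SigmaI finite_subset)
  moreover have "(v, v) \<notin> R" for v
  proof
    assume "(v, v) \<in> R"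
    moreover have "(v, v) \<notin> copies N n" using \<open>N > 0\<close> by (auto simp: copies_def box_def box_adj_def)
    ultimately have "far (N + 2) (R - {(v, v), (v, v)}) v v" by (intro D(4)) auto
    then show False using not_far_refl by (metis add_gr_0 zero_less_numeral)
  qed
  ultimately show ?thesis using D(1,2)
    by unfold_locales (auto simp: symmetric_def finite_verts_of)
qed

lemma regular_graph_iff_card_Image:
  "regular_graph d G \<longleftrightarrow> (\<forall>v\<in>pverts G. card (parcs G `` {v}) = d)"
proof -
  have "card {e \<in> parcs G. fst e = v} = card (parcs G `` {v})" for v
    by (rule bij_betw_same_card[of snd]) (auto simp: bij_betw_def inj_on_def image_iff)
  then show ?thesis by (simp add: regular_graph_def out_degree_def out_arcs_def)
qed

theorem theorem1p2:
  fixes d g :: nat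
  assumes "d \<ge> 3" and "g \<ge> 7" and "odd g"
  shows "\<exists>F :: nat pair_pre_digraph set. infinite F \<and> mutually_rigid F \<and>
           (\<forall>G \<in> F. pair_graph G \<and> regular_graph d G \<and> odd_girth G = enat g)"
proof -
  define N where "N = g - 2"
  have N: "N \<ge> 5" "odd N" "N + 2 = g" using assms(2,3) by (auto simp: N_def)
  define b where "b = N + 2 + 2 * (\<Sum>k\<le>N + 2. d ^ k)"
  define I where "I = {n. even n \<and> n > b}"
  have "\<forall>n\<in>I. \<exists>R. necklace N n R \<and> (\<forall>v\<in>verts_of N n. card (R `` {v}) = d)"
    using exists_regular_necklace[OF N(1) assms(1)] unfolding I_def b_def by blast
  then obtain R where R: "\<And>n. n \<in> I \<Longrightarrow> necklace N n (R n)"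
    "\<And>n v. n \<in> I \<Longrightarrow> v \<in> verts_of N n \<Longrightarrow> card (R n `` {v}) = d"
    by metis
  define G where "G n = \<lparr>pverts = verts_of N n, parcs = R n\<rparr>" for n
  have pos: "n > 0" if "n \<in> I" for n using that by (simp add: I_def)
  have hom: "n = n' \<and> (\<forall>v\<in>verts_of N n. h v = v)"
    if "n \<in> I" "n' \<in> I" "graph_hom (G n) (G n') h" for n n' h
    using that(3) necklace_hom[OF N(1,2) R(1)[OF that(1)] R(1)[OF that(2)] pos[OF that(1)], of h]
    unfolding graph_hom_def G_def by fastforce
  have "inj_on G I"
  proof (rule inj_onI)
    fix n n' assume *: "n \<in> I" "n' \<in> I" "G n = G n'"
    \<comment> \<open>The identity is a homomorphism between equal graphs, so these have equally
      many copies.\<close>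
    have "graph_hom (G n) (G n) id" unfolding graph_hom_def by auto
    then show "n = n'" using hom[OF *(1,2), of id] *(3) by simp
  qed
  moreover have "infinite I"
    unfolding infinite_nat_iff_unbounded
  proof
    fix m show "\<exists>n>m. n \<in> I"
      by (rule exI[of _ "2 * (m + b + 1)"]) (simp add: I_def)
  qed
  ultimately have "infinite (G ` I)" by (simp add: finite_image_iff)
  moreover have "mutually_rigid (G ` I)"
    unfolding mutually_rigid_def rigid_def
  proof (intro conjI ballI allI impI notI)
    show "h v = v" if "H \<in> G ` I" "graph_hom H H h" "v \<in> pverts H" for H h v
      using that hom by (auto simp: G_def)
    show False if "H \<in> G ` I" "H' \<in> G ` I" "H \<noteq> H'" "\<exists>h. graph_hom H H' h" for H H'
      using that hom by blast
  qed
  moreover have "pair_graph H \<and> regular_graph d H \<and> odd_girth H = enat g" if "H \<in> G ` I" for H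
  proof -
    from that obtain n where n: "n \<in> I" "H = G n" by blast
    show ?thesis unfolding n(2)
      using necklace_pair_graph[OF _ R(1)[OF n(1)]] R(2)[OF n(1)] N
        necklace_odd_girth[OF N(1,2) pos[OF n(1)] R(1)[OF n(1)]]
      by (auto simp: G_def regular_graph_iff_card_Image)
  qed
  ultimately show ?thesis by blast
qed

end
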